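(* Let $W=W_{B_n}$ and let $V$ be a $\mathbb CW^-$-module. The action of $\xi_i$ on the $\ddot{\mathfrak H}^-_W$-module $\mathbb C[y_1,\dots,y_n]\otimes V$ is realized as a Dunkl operator as follows. For any polynomial $f\in\mathbb C[y_1,\dots,y_n]$ and any vector $\mathsf v\in V$, $$\xi_i\circ(f\otimes\mathsf v)=u\sum_{k\ne i}\frac{f-f^{s_{ki}}}{y_i-y_k}\otimes[k,i]\,\mathsf v-u\sum_{k\ne i}\frac{f-f^{\overline{s}_{ki}}}{y_i+y_k}\otimes\overline{[k,i]}\,\mathsf v-v\,\frac{f-f^{\tau_i}}{2y_i}\otimes\overline{[i]}\,\mathsf v ,$$ where $u,v\in\mathbb C$ are the parameters of $\ddot{\mathfrak H}^-_W$.
   Context: Ground field $\mathbb C$, $u,v\in\mathbb C$. $W=W_{B_n}$ ($n\ge2$) is the group of signed permutations acting on $y_1,\dots,y_n$. For $i\ne j$: $s_{ij}$ swaps $y_i,y_j$; $\overline{s}_{ij}$ sends $y_i\mapsto-y_j$, $y_j\mapsto-y_i$; $\tau_i$ sends $y_i\mapsto-y_i$ (other $y_k$ fixed). $s_i=s_{i,i+1}$ for $i\le n-1$, $s_n=\tau_n$. $f^\sigma$ denotes the induced action of $\sigma\in W$ on $f\in\mathbb C[y_1,\dots,y_n]$. The spin Weyl group algebra $\mathbb CW^-$ of type $B_n$ is generated by $t_1,\dots,t_n$ with $t_i^2=1$ (all $i$); $t_it_{i+1}t_i=t_{i+1}t_it_{i+1}$ ($1\le i\le n-2$); $(t_it_j)^2=-1$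 for $i,j\le n-1$, $|i-j|>1$; $(t_it_n)^2=-1$ for $i\ne n-1,n$; $(t_{n-1}t_n)^4=-1$. Put $t_{i\uparrow j}=t_it_{i+1}\cdots t_j$ if $i\le j$, $1$ otherwise; $t_{i\downarrow j}=t_it_{i-1}\cdots t_j$ if $i\ge j$, $1$ otherwise. For $1\le i<j\le n$: $[i,j]=(-1)^{j-i-1}t_{j-1}\cdots t_{i+1}t_it_{i+1}\cdots t_{j-1}$, $[j,i]=-[i,j]$; $\overline{[i,j]}=\overline{[j,i]}=(-1)^{j-i}t_{j\uparrow n-1}t_{i\uparrow n-2}\,t_nt_{n-1}t_n\,t_{n-2\downarrow i}t_{n-1\downarrow j}$; and $\overline{[i]}=(-1)^{n-i}t_i\cdots t_{n-1}t_nt_{n-1}\cdots t_i$ ($1\le i\le n$). The rational spin double affine Hecke algebra $\ddot{\mathfrak H}^-_W$ of type $B_n$ is generated by $\xi_i,y_i$ ($1\le i\le n$) and $\mathbb CW^-$, subject to: $y_iy_j=y_jy_i$; $\xi_i\xi_j=-\xi_j\xi_i$ ($i\ne j$); for $1\le i\le n-1$: $t_iy_i=y_{i+1}t_i$, $t_i\xi_i=-\xi_{i+1}t_i$, $t_iy_j=y_jt_i$, $t_i\xi_j=-\xi_jt_i$ ($j\ne i,i+1$); $t_ny_n=-y_nt_n$, $t_n\xi_n=-\xi_nt_n$, $t_ny_j=y_jt_n$, $t_n\xi_j=-\xi_jt_n$ ($j\ne n$); $y_j\xi_i-\xi_iy_j=-u[i,j]+u\overline{[i,j]}$ ($i\ne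 j$); $y_i\xi_i-\xi_iy_i=u\sum_{k\ne i}([i,k]+\overline{[i,k]})+v\overline{[i]}$. It has the triangular decomposition $\mathcal C[\xi_1,\dots,\xi_n]\otimes\mathbb CW^-\otimes\mathbb C[y_1,\dots,y_n]$, where $\mathcal C[\xi_1,\dots,\xi_n]$ is the skew-polynomial algebra with $\xi_i\xi_j=-\xi_j\xi_i$ ($i\ne j$). Let $\mathfrak h_\xi$ be the subalgebra generated by the $\xi_i$ and $\mathbb CW^-$. A $\mathbb CW^-$-module $V$ is extended to an $\mathfrak h_\xi$-module by letting all $\xi_i$ act by $0$, and $V_\xi=\mathrm{Ind}_{\mathfrak h_\xi}^{\ddot{\mathfrak H}^-_W}V$ is identified with $\mathbb C[y_1,\dots,y_n]\otimes V$; this is the module structure in question ($t_i$ acts as $s_i\otimes t_i$; $y_i$ acts by left multiplication; $\circ$ denotes the action). *)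

theory Defs
  imports Complex_Main "HOL-Library.Poly_Mapping" "HOL-Algebra.QuotRing"
    "HOL-Algebra.Generated_Rings" "HOL-Algebra.Free_Abelian_Groups"
begin

section \<open>Algebras given by generators and relations\<close>

text \<open>The free monoid is written additively so that \<open>'g word \<Rightarrow>\<^sub>0 complex\<close>, with the
  convolution product of \<^theory>\<open>HOL-Library.Poly_Mapping\<close>, is the free associative complex
  algebra on \<open>'g\<close>.\<close>

datatype 'g word = Word (letters: "'g list")

instantiation word :: (type) monoid_add
begin
definition zero_word :: "'a word" where "0 = Word []"
definition plus_word :: "'a word \<Rightarrow> 'a word \<Rightarrow> 'a word"
  where "a + b = Word (letters a @ letters b)"
instance by standard (simp_all add: zero_word_def plus_word_def)
end

lemma letters_zero [simp]: "letters 0 = []"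
  by (simp add: zero_word_def)

lemma letters_plus [simp]: "letters (a + b) = letters a @ letters b"
  by (simp add: plus_word_def)

definition free_algebra :: "'g set \<Rightarrow> ('g word \<Rightarrow>\<^sub>0 complex) ring" where
  "free_algebra G = \<lparr>carrier = {p. \<forall>w\<in>Poly_Mapping.keys p. set (letters w) \<subseteq> G},
     monoid.mult = (*), monoid.one = 1, ring.zero = 0, ring.add = (+)\<rparr>"

definition gen :: "'g \<Rightarrow> ('g word \<Rightarrow>\<^sub>0 complex)" where
  "gen g = Poly_Mapping.single (Word [g]) 1"

definition scal :: "complex \<Rightarrow> ('g word \<Rightarrow>\<^sub>0 complex)" where
  "scal c = Poly_Mapping.single 0 c"

definition rel_ideal :: "'g set \<Rightarrow> ('g word \<Rightarrow>\<^sub>0 complex) set \<Rightarrow> ('g word \<Rightarrow>\<^sub>0 complex) set" where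
  "rel_ideal G R = genideal (free_algebra G) R"

definition presented :: "'g set \<Rightarrow> ('g word \<Rightarrow>\<^sub>0 complex) set \<Rightarrow> ('g word \<Rightarrow>\<^sub>0 complex) set ring" where
  "presented G R = free_algebra G Quot rel_ideal G R"

definition cls :: "'g set \<Rightarrow> ('g word \<Rightarrow>\<^sub>0 complex) set \<Rightarrow> ('g word \<Rightarrow>\<^sub>0 complex)
    \<Rightarrow> ('g word \<Rightarrow>\<^sub>0 complex) set" where
  "cls G R p = rel_ideal G R +>\<^bsub>free_algebra G\<^esub> p"

lemma free_algebra_simps [simp]:
  "monoid.mult (free_algebra G) = (*)" "monoid.one (free_algebra G) = 1"
  "ring.zero (free_algebra G) = 0" "ring.add (free_algebra G) = (+)"
  by (simp_all add: free_algebra_def)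

lemma free_algebra_carrier:
  "p \<in> carrier (free_algebra G) \<longleftrightarrow> (\<forall>w\<in>Poly_Mapping.keys p. set (letters w) \<subseteq> G)"
  by (simp add: free_algebra_def)

lemma free_algebra_add:
  "p \<in> carrier (free_algebra G) \<Longrightarrow> q \<in> carrier (free_algebra G) \<Longrightarrow> p + q \<in> carrier (free_algebra G)"
  using Poly_Mapping.keys_add[of p q] by (auto simp: free_algebra_carrier)

lemma free_algebra_uminus:
  "p \<in> carrier (free_algebra G) \<Longrightarrow> - p \<in> carrier (free_algebra G)"
  by (simp add: free_algebra_carrier)

lemma free_algebra_diff:
  "p \<in> carrier (free_algebra G) \<Longrightarrow> q \<in> carrier (free_algebra G) \<Longrightarrow> p - q \<in> carrier (free_algebra G)"
  using free_algebra_add[of p G "- q"] free_algebra_uminus[of q G] by simp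

lemma free_algebra_mult:
  "p \<in> carrier (free_algebra G) \<Longrightarrow> q \<in> carrier (free_algebra G) \<Longrightarrow> p * q \<in> carrier (free_algebra G)"
  using keys_mult[of p q] by (fastforce simp: free_algebra_carrier)

lemma free_algebra_zero: "0 \<in> carrier (free_algebra G)"
  by (simp add: free_algebra_carrier)

lemma free_algebra_one: "1 \<in> carrier (free_algebra G)"
  by (simp add: free_algebra_carrier)

lemma free_algebra_scal: "scal c \<in> carrier (free_algebra G)"
  by (simp add: free_algebra_carrier scal_def)

lemma free_algebra_gen: "g \<in> G \<Longrightarrow> gen g \<in> carrier (free_algebra G)"
  by (simp add: free_algebra_carrier gen_def)

lemma free_algebra_power:
  "p \<in> carrier (free_algebra G) \<Longrightarrow> p ^ k \<in> carrier (free_algebra G)"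
  by (induction k) (auto intro: free_algebra_one free_algebra_mult)

lemma free_algebra_prod_list:
  "(\<And>p. p \<in> set ps \<Longrightarrow> p \<in> carrier (free_algebra G)) \<Longrightarrow> prod_list ps \<in> carrier (free_algebra G)"
  by (induction ps) (auto intro: free_algebra_one free_algebra_mult)

lemma free_algebra_sum:
  "(\<And>k. k \<in> K \<Longrightarrow> f k \<in> carrier (free_algebra G)) \<Longrightarrow> sum f K \<in> carrier (free_algebra G)"
  by (induction K rule: infinite_finite_induct) (auto intro: free_algebra_zero free_algebra_add)

lemma ring_free_algebra: "ring (free_algebra G)"
proof (rule ringI)
  show "abelian_group (free_algebra G)"
  proof (rule abelian_groupI)
    fix x assume "x \<in> carrier (free_algebra G)"
    then show "\<exists>y\<in>carrier (free_algebra G). y \<oplus>\<^bsub>free_algebra G\<^esub> x = \<zero>\<^bsub>free_algebra G\<^esub>"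
      by (intro bexI[of _ "- x"]) (simp_all add: free_algebra_uminus)
  qed (simp_all add: free_algebra_add free_algebra_zero algebra_simps)
  show "monoid (free_algebra G)"
    by (rule monoidI) (simp_all add: free_algebra_mult free_algebra_one algebra_simps)
qed (simp_all add: algebra_simps)


section \<open>The spin Weyl group algebra of type \<open>B\<^sub>n\<close>\<close>

datatype letter = GenT nat | GenXi nat | GenY nat

type_synonym falg = "letter word \<Rightarrow>\<^sub>0 complex"

definition t_gen :: "nat \<Rightarrow> falg" where "t_gen i = gen (GenT i)"
definition xi_gen :: "nat \<Rightarrow> falg" where "xi_gen i = gen (GenXi i)"
definition y_gen :: "nat \<Rightarrow> falg" where "y_gen i = gen (GenY i)"

text \<open>For \<open>i > j\<close> (resp. \<open>i < j\<close>) the list is empty and the product is \<open>1\<close>.\<close>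

definition t_up :: "nat \<Rightarrow> nat \<Rightarrow> falg" where
  "t_up i j = prod_list (map t_gen [i..<Suc j])"
definition t_down :: "nat \<Rightarrow> nat \<Rightarrow> falg" where
  "t_down i j = prod_list (map t_gen (rev [j..<Suc i]))"

definition bracket_lt :: "nat \<Rightarrow> nat \<Rightarrow> falg" where
  "bracket_lt i j = (-1) ^ (j - i - 1) * t_down (j - 1) (i + 1) * t_gen i * t_up (i + 1) (j - 1)"

definition bracket :: "nat \<Rightarrow> nat \<Rightarrow> falg" where
  "bracket i j = (if i < j then bracket_lt i j else - bracket_lt j i)"

definition bar_bracket_lt :: "nat \<Rightarrow> nat \<Rightarrow> nat \<Rightarrow> falg" where
  "bar_bracket_lt n i j = (-1) ^ (j - i) * t_up j (n - 1) * t_up i (n - 2)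
     * t_gen n * t_gen (n - 1) * t_gen n * t_down (n - 2) i * t_down (n - 1) j"

definition bar_bracket :: "nat \<Rightarrow> nat \<Rightarrow> nat \<Rightarrow> falg" where
  "bar_bracket n i j = (if i < j then bar_bracket_lt n i j else bar_bracket_lt n j i)"

definition bar_single :: "nat \<Rightarrow> nat \<Rightarrow> falg" where
  "bar_single n i = (-1) ^ (n - i) * t_up i (n - 1) * t_gen n * t_down (n - 1) i"

text \<open>A relation \<open>a = b\<close> is recorded as the element \<open>a - b\<close>.\<close>

definition spin_gens :: "nat \<Rightarrow> letter set" where
  "spin_gens n = GenT ` {1..n}"

definition spin_rels :: "nat \<Rightarrow> falg set" where
  "spin_rels n =
     {t_gen i * t_gen i - 1 | i. i \<in> {1..n}}
   \<union> {t_gen i * t_gen (i + 1) * t_gen i - t_gen (i + 1) * t_gen i * t_gen (i + 1) | i. 1 \<le> i \<and> i + 2 \<le> n}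
   \<union> {(t_gen i * t_gen j) ^ 2 + 1 | i j. i \<in> {1..n-1} \<and> j \<in> {1..n-1} \<and> (i + 1 < j \<or> j + 1 < i)}
   \<union> {(t_gen i * t_gen n) ^ 2 + 1 | i. i \<in> {1..n} \<and> i \<noteq> n - 1 \<and> i \<noteq> n}
   \<union> {(t_gen (n - 1) * t_gen n) ^ 4 + 1}"

definition spin_alg :: "nat \<Rightarrow> falg set ring" where
  "spin_alg n = presented (spin_gens n) (spin_rels n)"

definition spin_cls :: "nat \<Rightarrow> falg \<Rightarrow> falg set" where
  "spin_cls n = cls (spin_gens n) (spin_rels n)"

locale spin_module = vector_space scale
  for scale :: "complex \<Rightarrow> 'v::ab_group_add \<Rightarrow> 'v" +
  fixes n :: nat and rho :: "falg set \<Rightarrow> 'v \<Rightarrow> 'v"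
  assumes rho_linear: "a \<in> carrier (spin_alg n) \<Longrightarrow> Vector_Spaces.linear scale scale (rho a)"
    and rho_add: "\<lbrakk>a \<in> carrier (spin_alg n); b \<in> carrier (spin_alg n)\<rbrakk>
          \<Longrightarrow> rho (a \<oplus>\<^bsub>spin_alg n\<^esub> b) x = rho a x + rho b x"
    and rho_mult: "\<lbrakk>a \<in> carrier (spin_alg n); b \<in> carrier (spin_alg n)\<rbrakk>
          \<Longrightarrow> rho (a \<otimes>\<^bsub>spin_alg n\<^esub> b) x = rho a (rho b x)"
    and rho_scal: "rho (spin_cls n (scal c)) x = scale c x"


section \<open>The rational spin double affine Hecke algebra\<close>

definition daha_gens :: "nat \<Rightarrow> letter set" where
  "daha_gens n = GenT ` {1..n} \<union> GenXi ` {1..n} \<union> GenY ` {1..n}"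

definition daha_rels :: "nat \<Rightarrow> complex \<Rightarrow> complex \<Rightarrow> falg set" where
  "daha_rels n u v = spin_rels n
   \<union> {y_gen i * y_gen j - y_gen j * y_gen i | i j. i \<in> {1..n} \<and> j \<in> {1..n}}
   \<union> {xi_gen i * xi_gen j + xi_gen j * xi_gen i | i j. i \<in> {1..n} \<and> j \<in> {1..n} \<and> i \<noteq> j}
   \<union> {t_gen i * y_gen i - y_gen (i + 1) * t_gen i | i. i \<in> {1..n-1}}
   \<union> {t_gen i * xi_gen i + xi_gen (i + 1) * t_gen i | i. i \<in> {1..n-1}}
   \<union> {t_gen i * y_gen j - y_gen j * t_gen i | i j. i \<in> {1..n-1} \<and> j \<in> {1..n} \<and> j \<noteq> i \<and> j \<noteq> i + 1}
   \<union> {t_gen i * xi_gen j + xi_gen j * t_gen i | i j. i \<in> {1..n-1} \<and> j \<in> {1..n} \<and> j \<noteq> i \<and> j \<noteq> i + 1}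
   \<union> {t_gen n * y_gen n + y_gen n * t_gen n}
   \<union> {t_gen n * xi_gen n + xi_gen n * t_gen n}
   \<union> {t_gen n * y_gen j - y_gen j * t_gen n | j. j \<in> {1..n} \<and> j \<noteq> n}
   \<union> {t_gen n * xi_gen j + xi_gen j * t_gen n | j. j \<in> {1..n} \<and> j \<noteq> n}
   \<union> {(y_gen j * xi_gen i - xi_gen i * y_gen j) - (- scal u * bracket i j + scal u * bar_bracket n i j) | i j.
        i \<in> {1..n} \<and> j \<in> {1..n} \<and> i \<noteq> j}
   \<union> {(y_gen i * xi_gen i - xi_gen i * y_gen i)
        - (scal u * (\<Sum>k\<in>{1..n}-{i}. bracket i k + bar_bracket n i k) + scal v * bar_single n i) | i.
        i \<in> {1..n}}"

definition daha :: "nat \<Rightarrow> complex \<Rightarrow> complex \<Rightarrow> falg set ring" where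
  "daha n u v = presented (daha_gens n) (daha_rels n u v)"

definition daha_cls :: "nat \<Rightarrow> complex \<Rightarrow> complex \<Rightarrow> falg \<Rightarrow> falg set" where
  "daha_cls n u v = cls (daha_gens n) (daha_rels n u v)"

text \<open>The generated ideal is only meaningful for relations lying in the free algebra.\<close>

lemma t_up_carrier:
  "GenT ` {i..j} \<subseteq> G \<Longrightarrow> t_up i j \<in> carrier (free_algebra G)"
  unfolding t_up_def t_gen_def by (rule free_algebra_prod_list) (force intro: free_algebra_gen)

lemma t_down_carrier:
  "GenT ` {j..i} \<subseteq> G \<Longrightarrow> t_down i j \<in> carrier (free_algebra G)"
  unfolding t_down_def t_gen_def by (rule free_algebra_prod_list) (force intro: free_algebra_gen)

lemmas free_algebra_intros =
  free_algebra_add free_algebra_diff free_algebra_uminus free_algebra_mult free_algebra_power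
  free_algebra_one free_algebra_scal free_algebra_gen free_algebra_sum

lemma bracket_carrier:
  assumes "GenT ` {1..n} \<subseteq> G" "i \<in> {1..n}" "j \<in> {1..n}" "i \<noteq> j"
  shows "bracket i j \<in> carrier (free_algebra G)"
proof -
  have *: "bracket_lt k l \<in> carrier (free_algebra G)" if "1 \<le> k" "k < l" "l \<le> n" for k l
    unfolding bracket_lt_def t_gen_def
    by (intro free_algebra_intros t_up_carrier t_down_carrier) (use assms(1) that in force)+
  show ?thesis
    using assms(2-4) * by (auto simp: bracket_def intro!: free_algebra_uminus)
qed

lemma bar_bracket_carrier:
  assumes "GenT ` {1..n} \<subseteq> G" "i \<in> {1..n}" "j \<in> {1..n}" "i \<noteq> j"
  shows "bar_bracket n i j \<in> carrier (free_algebra G)"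
proof -
  have *: "bar_bracket_lt n k l \<in> carrier (free_algebra G)" if "1 \<le> k" "k < l" "l \<le> n" for k l
    unfolding bar_bracket_lt_def t_gen_def
    by (intro free_algebra_intros t_up_carrier t_down_carrier) (use assms(1) that in force)+
  show ?thesis
    using assms(2-4) * by (auto simp: bar_bracket_def)
qed

lemma bar_single_carrier:
  assumes "GenT ` {1..n} \<subseteq> G" "i \<in> {1..n}"
  shows "bar_single n i \<in> carrier (free_algebra G)"
  unfolding bar_single_def t_gen_def
  by (intro free_algebra_intros t_up_carrier t_down_carrier) (use assms in force)+

lemma spin_rels_carrier:
  assumes "n \<ge> 2" "GenT ` {1..n} \<subseteq> G"
  shows "spin_rels n \<subseteq> carrier (free_algebra G)"
  unfolding spin_rels_def t_gen_def using assms
  by (auto intro!: free_algebra_intros)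

lemma daha_rels_carrier:
  assumes "n \<ge> 2"
  shows "daha_rels n u v \<subseteq> carrier (free_algebra (daha_gens n))"
proof -
  have T: "GenT ` {1..n} \<subseteq> daha_gens n" by (auto simp: daha_gens_def)
  have G: "i \<in> {1..n} \<Longrightarrow> GenT i \<in> daha_gens n" "i \<in> {1..n} \<Longrightarrow> GenXi i \<in> daha_gens n"
    "i \<in> {1..n} \<Longrightarrow> GenY i \<in> daha_gens n" for i by (auto simp: daha_gens_def)
  show ?thesis
    unfolding daha_rels_def t_gen_def xi_gen_def y_gen_def
    using assms spin_rels_carrier[OF assms T]
    by (auto intro!: free_algebra_intros G bracket_carrier[OF T] bar_bracket_carrier[OF T]
        bar_single_carrier[OF T])
qed


section \<open>The induced module\<close>

definition h_xi :: "nat \<Rightarrow> complex \<Rightarrow> complex \<Rightarrow> falg set set" where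
  "h_xi n u v = generate_ring (daha n u v)
     (daha_cls n u v ` (xi_gen ` {1..n} \<union> carrier (free_algebra (spin_gens n))))"

text \<open>The extension of \<open>rho\<close> to \<open>h_xi\<close> by \<open>xi_gen i \<mapsto> 0\<close>, as a graph: \<open>xi_graph n u v rho h F\<close> says that
  \<open>h\<close> acts on \<open>V\<close> by \<open>F\<close>. That this graph is a function is a consequence of the triangular
  decomposition; using the graph makes the induced module meaningful without presupposing it.\<close>

inductive xi_graph :: "nat \<Rightarrow> complex \<Rightarrow> complex \<Rightarrow> (falg set \<Rightarrow> 'v::ab_group_add \<Rightarrow> 'v)
    \<Rightarrow> falg set \<Rightarrow> ('v \<Rightarrow> 'v) \<Rightarrow> bool"
  for n u v rho where
  xi: "i \<in> {1..n} \<Longrightarrow> xi_graph n u v rho (daha_cls n u v (xi_gen i)) (\<lambda>x. 0)"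
| spin: "p \<in> carrier (free_algebra (spin_gens n))
    \<Longrightarrow> xi_graph n u v rho (daha_cls n u v p) (rho (spin_cls n p))"
| add: "xi_graph n u v rho a F \<Longrightarrow> xi_graph n u v rho b F'
    \<Longrightarrow> xi_graph n u v rho (a \<oplus>\<^bsub>daha n u v\<^esub> b) (\<lambda>x. F x + F' x)"
| mult: "xi_graph n u v rho a F \<Longrightarrow> xi_graph n u v rho b F'
    \<Longrightarrow> xi_graph n u v rho (a \<otimes>\<^bsub>daha n u v\<^esub> b) (\<lambda>x. F (F' x))"

lemma ideal_rel: "n \<ge> 2 \<Longrightarrow> ideal (rel_ideal (daha_gens n) (daha_rels n u v)) (free_algebra (daha_gens n))"
  unfolding rel_ideal_def by (intro ring.genideal_ideal ring_free_algebra daha_rels_carrier)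

lemma ring_daha: "n \<ge> 2 \<Longrightarrow> ring (daha n u v)"
  unfolding daha_def presented_def by (intro ideal.quotient_is_ring ideal_rel)

lemma daha_cls_hom:
  "n \<ge> 2 \<Longrightarrow> daha_cls n u v \<in> ring_hom (free_algebra (daha_gens n)) (daha n u v)"
  unfolding daha_def presented_def daha_cls_def cls_def by (intro ideal.rcos_ring_hom ideal_rel)

lemma xi_graph_domain:
  assumes n: "n \<ge> 2"
  shows "(\<exists>F. xi_graph n u v rho h F) \<longleftrightarrow> h \<in> h_xi n u v"
proof
  assume "\<exists>F. xi_graph n u v rho h F"
  then obtain F where "xi_graph n u v rho h F" ..
  then show "h \<in> h_xi n u v"
    unfolding h_xi_def by induction (auto intro: generate_ring.intros)
next
  interpret ring "daha n u v" by (rule ring_daha[OF n])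
  interpret hom: ring_hom_ring "free_algebra (daha_gens n)" "daha n u v" "daha_cls n u v"
    by (intro ring_hom_ringI2 ring_free_algebra ring_daha daha_cls_hom n)
  have sub: "carrier (free_algebra (spin_gens n)) \<subseteq> carrier (free_algebra (daha_gens n))"
    by (auto simp: free_algebra_carrier spin_gens_def daha_gens_def) blast
  have xic: "xi_gen i \<in> carrier (free_algebra (daha_gens n))" if "i \<in> {1..n}" for i
    using that by (auto simp: xi_gen_def daha_gens_def intro!: free_algebra_gen)
  have gens: "daha_cls n u v ` (xi_gen ` {1..n} \<union> carrier (free_algebra (spin_gens n)))
      \<subseteq> carrier (daha n u v)"
    using sub xic by (auto intro!: hom.hom_closed)
  assume "h \<in> h_xi n u v"
  then show "\<exists>F. xi_graph n u v rho h F"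
    unfolding h_xi_def
  proof induction
    case one
    have "\<one>\<^bsub>daha n u v\<^esub> = daha_cls n u v 1" using hom.hom_one by simp
    then show ?case by (metis xi_graph.spin free_algebra_one)
  next
    case (incl h)
    then show ?case using xi_graph.xi xi_graph.spin by blast
  next
    case (a_inv h)
    then obtain F where F: "xi_graph n u v rho h F" by blast
    have h: "h \<in> carrier (daha n u v)" using a_inv generate_ring_in_carrier[OF gens] by blast
    have 1: "1 \<in> carrier (free_algebra (daha_gens n))" by (rule free_algebra_one)
    have "daha_cls n u v (- 1) = \<ominus>\<^bsub>daha n u v\<^esub> \<one>\<^bsub>daha n u v\<^esub>"
    proof -
      have "daha_cls n u v (- 1) \<oplus>\<^bsub>daha n u v\<^esub> daha_cls n u v 1 = daha_cls n u v 0"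
        using hom.hom_add[OF free_algebra_uminus[OF 1] 1] by simp
      then have "daha_cls n u v (- 1) \<oplus>\<^bsub>daha n u v\<^esub> \<one>\<^bsub>daha n u v\<^esub> = \<zero>\<^bsub>daha n u v\<^esub>"
        using hom.hom_one hom.hom_zero by simp
      then show ?thesis
        using minus_equality[OF _ one_closed hom.hom_closed[OF free_algebra_uminus[OF 1]]] by simp
    qed
    then have "\<ominus>\<^bsub>daha n u v\<^esub> h = daha_cls n u v (- 1) \<otimes>\<^bsub>daha n u v\<^esub> h"
      using h by (simp add: l_minus)
    then show ?case
      using xi_graph.mult[OF xi_graph.spin F] free_algebra_uminus[OF free_algebra_one] by metis
  next
    case eng_add
    then show ?case by (blast intro: xi_graph.add)
  next
    case eng_mult
    then show ?case by (blast intro: xi_graph.mult)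
  qed
qed

text \<open>The tensor product over \<open>h_xi\<close> of the algebra with \<open>V\<close>: the free abelian group on pairs modulo
  biadditivity and \<open>(a h) \<otimes> x = a \<otimes> (h x)\<close>.\<close>

definition pair_group :: "nat \<Rightarrow> complex \<Rightarrow> complex \<Rightarrow> ((falg set \<times> 'v) \<Rightarrow>\<^sub>0 int) monoid" where
  "pair_group n u v = free_Abelian_group (carrier (daha n u v) \<times> UNIV)"

definition tensor_rels :: "nat \<Rightarrow> complex \<Rightarrow> complex \<Rightarrow> (falg set \<Rightarrow> 'v::ab_group_add \<Rightarrow> 'v)
    \<Rightarrow> ((falg set \<times> 'v) \<Rightarrow>\<^sub>0 int) set" where
  "tensor_rels n u v rho =
     {frag_of (a \<oplus>\<^bsub>daha n u v\<^esub> b, x) - frag_of (a, x) - frag_of (b, x) | a b x.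
        a \<in> carrier (daha n u v) \<and> b \<in> carrier (daha n u v)}
   \<union> {frag_of (a, x + x') - frag_of (a, x) - frag_of (a, x') | a x x'. a \<in> carrier (daha n u v)}
   \<union> {frag_of (a \<otimes>\<^bsub>daha n u v\<^esub> h, x) - frag_of (a, F x) | a h F x.
        a \<in> carrier (daha n u v) \<and> xi_graph n u v rho h F}"

definition tensor_null :: "nat \<Rightarrow> complex \<Rightarrow> complex \<Rightarrow> (falg set \<Rightarrow> 'v::ab_group_add \<Rightarrow> 'v)
    \<Rightarrow> ((falg set \<times> 'v) \<Rightarrow>\<^sub>0 int) set" where
  "tensor_null n u v rho = generate (pair_group n u v) (tensor_rels n u v rho)"

definition V_xi :: "nat \<Rightarrow> complex \<Rightarrow> complex \<Rightarrow> (falg set \<Rightarrow> 'v::ab_group_add \<Rightarrow> 'v)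
    \<Rightarrow> ((falg set \<times> 'v) \<Rightarrow>\<^sub>0 int) set monoid" where
  "V_xi n u v rho = pair_group n u v Mod tensor_null n u v rho"

definition ind_cls :: "nat \<Rightarrow> complex \<Rightarrow> complex \<Rightarrow> (falg set \<Rightarrow> 'v::ab_group_add \<Rightarrow> 'v)
    \<Rightarrow> ((falg set \<times> 'v) \<Rightarrow>\<^sub>0 int) \<Rightarrow> ((falg set \<times> 'v) \<Rightarrow>\<^sub>0 int) set" where
  "ind_cls n u v rho c = tensor_null n u v rho #>\<^bsub>pair_group n u v\<^esub> c"

definition ind_act :: "nat \<Rightarrow> complex \<Rightarrow> complex \<Rightarrow> (falg set \<Rightarrow> 'v::ab_group_add \<Rightarrow> 'v) \<Rightarrow> falg set
    \<Rightarrow> ((falg set \<times> 'v) \<Rightarrow>\<^sub>0 int) set \<Rightarrow> ((falg set \<times> 'v) \<Rightarrow>\<^sub>0 int) set" where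
  "ind_act n u v rho h C =
     (\<Union>c\<in>C. ind_cls n u v rho (frag_extend (\<lambda>(a, x). frag_of (h \<otimes>\<^bsub>daha n u v\<^esub> a, x)) c))"


section \<open>Polynomials and the identification with \<open>\<complex>[y\<^sub>1,\<dots>,y\<^sub>n] \<otimes> V\<close>\<close>

type_synonym cpoly = "(nat \<Rightarrow>\<^sub>0 nat) \<Rightarrow>\<^sub>0 complex"

definition polys :: "nat \<Rightarrow> cpoly set" where
  "polys n = {f. \<forall>m\<in>Poly_Mapping.keys f. Poly_Mapping.keys m \<subseteq> {1..n}}"

definition yvar :: "nat \<Rightarrow> cpoly" where
  "yvar i = Poly_Mapping.single (Poly_Mapping.single i 1) 1"

text \<open>An element \<open>\<sigma>\<close> of \<open>W\<close> is given by the images of the \<open>y\<^sub>j\<close>; the action on polynomials is the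
  induced algebra homomorphism.\<close>

definition act_poly :: "(nat \<Rightarrow> cpoly) \<Rightarrow> cpoly \<Rightarrow> cpoly" where
  "act_poly \<sigma> f = (\<Sum>m\<in>Poly_Mapping.keys f. Poly_Mapping.single 0 (Poly_Mapping.lookup f m)
      * (\<Prod>j\<in>Poly_Mapping.keys m. \<sigma> j ^ Poly_Mapping.lookup m j))"

definition swap :: "nat \<Rightarrow> nat \<Rightarrow> nat \<Rightarrow> cpoly" where
  "swap i j = (\<lambda>k. if k = i then yvar j else if k = j then yvar i else yvar k)"
definition neg_swap :: "nat \<Rightarrow> nat \<Rightarrow> nat \<Rightarrow> cpoly" where
  "neg_swap i j = (\<lambda>k. if k = i then - yvar j else if k = j then - yvar i else yvar k)"
definition neg_at :: "nat \<Rightarrow> nat \<Rightarrow> cpoly" where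
  "neg_at i = (\<lambda>k. if k = i then - yvar i else yvar k)"

text \<open>Exact quotient; unique for \<open>q \<noteq> 0\<close> since \<^typ>\<open>cpoly\<close> is an integral domain.\<close>

definition pquot :: "cpoly \<Rightarrow> cpoly \<Rightarrow> cpoly" where
  "pquot p q = (THE g. g * q = p)"

text \<open>\<open>\<complex>[y\<^sub>1,\<dots>,y\<^sub>n] \<otimes> V\<close> is modelled as the finitely supported functions from monomials to \<open>V\<close>.\<close>

definition poly_tensor :: "nat \<Rightarrow> ((nat \<Rightarrow>\<^sub>0 nat) \<Rightarrow>\<^sub>0 'v::zero) set" where
  "poly_tensor n = {z. \<forall>m\<in>Poly_Mapping.keys z. Poly_Mapping.keys m \<subseteq> {1..n}}"

definition ptens :: "(complex \<Rightarrow> 'v \<Rightarrow> 'v) \<Rightarrow> cpoly \<Rightarrow> 'v::zero \<Rightarrow> (nat \<Rightarrow>\<^sub>0 nat) \<Rightarrow>\<^sub>0 'v" where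
  "ptens scale f x = Poly_Mapping.map (\<lambda>c. scale c x) f"

definition tscale :: "(complex \<Rightarrow> 'v \<Rightarrow> 'v) \<Rightarrow> complex \<Rightarrow> ((nat \<Rightarrow>\<^sub>0 nat) \<Rightarrow>\<^sub>0 'v::zero)
    \<Rightarrow> (nat \<Rightarrow>\<^sub>0 nat) \<Rightarrow>\<^sub>0 'v" where
  "tscale scale c z = Poly_Mapping.map (scale c) z"

definition ymonom :: "nat \<Rightarrow> (nat \<Rightarrow>\<^sub>0 nat) \<Rightarrow> falg" where
  "ymonom n m = prod_list (map (\<lambda>j. y_gen j ^ Poly_Mapping.lookup m j) [1..<Suc n])"

text \<open>The canonical map \<open>f \<otimes> x \<mapsto> f \<otimes> x\<close> from \<open>\<complex>[y\<^sub>1,\<dots>,y\<^sub>n] \<otimes> V\<close> to the induced module; by the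
  triangular decomposition it is bijective.\<close>

definition ident :: "nat \<Rightarrow> complex \<Rightarrow> complex \<Rightarrow> (falg set \<Rightarrow> 'v::ab_group_add \<Rightarrow> 'v)
    \<Rightarrow> ((nat \<Rightarrow>\<^sub>0 nat) \<Rightarrow>\<^sub>0 'v) \<Rightarrow> ((falg set \<times> 'v) \<Rightarrow>\<^sub>0 int) set" where
  "ident n u v rho z = ind_cls n u v rho
     (\<Sum>m\<in>Poly_Mapping.keys z. frag_of (daha_cls n u v (ymonom n m), Poly_Mapping.lookup z m))"

text \<open>The action transported along the identification.\<close>

definition poly_act :: "nat \<Rightarrow> complex \<Rightarrow> complex \<Rightarrow> (falg set \<Rightarrow> 'v::ab_group_add \<Rightarrow> 'v) \<Rightarrow> falg set
    \<Rightarrow> ((nat \<Rightarrow>\<^sub>0 nat) \<Rightarrow>\<^sub>0 'v) \<Rightarrow> (nat \<Rightarrow>\<^sub>0 nat) \<Rightarrow>\<^sub>0 'v" where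
  "poly_act n u v rho h z =
     the_inv_into (poly_tensor n) (ident n u v rho) (ind_act n u v rho h (ident n u v rho z))"

end

theory Submission
  imports Defs
begin

text \<open>The proof is an induction on \<open>f\<close> by multiplication with the variables. The constant case is
  \<open>\<xi>\<^sub>i \<circ> (1 \<otimes> x) = 0\<close>. Moving \<open>\<xi>\<^sub>i\<close> past \<open>y\<^sub>j\<close> produces brackets acting on \<open>f \<otimes> x\<close>; since every bracket is, up to sign, a
  conjugate of a generator by generators, it acts as \<open>\<sigma> \<otimes> bracket\<close> for the corresponding reflection
  \<open>\<sigma>\<close>. This matches term by term the twisted Leibniz rule
  \<open>\<Delta>(y\<^sub>j f) = y\<^sub>j \<Delta>(f) + \<Delta>(y\<^sub>j) f\<^sup>\<sigma>\<close> of the divided difference \<open>\<Delta>(f) = (f - f\<^sup>\<sigma>) / q\<close>, where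
  \<open>\<Delta>(y\<^sub>j)\<close> is a constant.\<close>

section \<open>Divided differences\<close>

text \<open>The signs match for a reason of symmetry. Dividing by y_i - y_k, the swap sends y_i to 1
  and y_k to -1, and [k,i] = -[i,k]; dividing by y_i + y_k, the signed swap sends both to 1, and the
  barred bracket is symmetric. Hence a single formula gives the commutator of
  \<open>\<xi>\<^sub>i\<close> and \<open>y\<^sub>j\<close> whether or not i = j, the contributing
  reflections being those that move y_j. The obstacle is the induced module itself. Its elements are
  cosets in a quotient of a free abelian group, where pairs add only modulo relations, and
  \<open>ident\<close> becomes a bijection only through the triangular decomposition. All
  computations are therefore congruences between representatives, and they yield an equation between
  two images under \<open>ident\<close>. Cancelling \<open>ident\<close> is the very last step,
  under the bijectivity premise of the second conjunct, and it requires the Dunkl side to lie in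
  \<open>poly_tensor n\<close>.\<close>

lemma single_plus_eq_update:
  "a \<notin> Poly_Mapping.keys f \<Longrightarrow> Poly_Mapping.update a b f = Poly_Mapping.single a b + f"
  by (rule poly_mapping_eqI) (auto simp: lookup_update lookup_add lookup_single in_keys_iff when_def)

text \<open>Dropping the freshness condition of \<open>update_induct\<close> turns the step into
  plain additivity.\<close>

lemma poly_mapping_single_induct [case_names zero add]:
  assumes "P 0" "\<And>m c f. P f \<Longrightarrow> P (Poly_Mapping.single m c + f)"
  shows "P (f :: 'a \<Rightarrow>\<^sub>0 'b::monoid_add)"
  by (induction f rule: update_induct) (simp_all add: assms single_plus_eq_update)

lemma yvar_power: "yvar a ^ b = Poly_Mapping.single (Poly_Mapping.single a b) 1"
proof (induction b)
  case (Suc b)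
  have "Poly_Mapping.single a (Suc b) = Poly_Mapping.single a 1 + Poly_Mapping.single a b"
    by (simp flip: single_add)
  with Suc show ?case by (simp add: yvar_def mult_single)
qed simp

lemma yvar_mult_single: "yvar j * Poly_Mapping.single m c = Poly_Mapping.single (Poly_Mapping.single j 1 + m) c"
  by (simp add: yvar_def mult_single)

text \<open>The variable set is a parameter so that one induction rule serves \<open>polys n\<close>
  (with \<open>A = {1..n}\<close>) and all polynomials (with \<open>A = UNIV\<close>).\<close>

definition in_vars :: "nat set \<Rightarrow> cpoly \<Rightarrow> bool" where
  "in_vars A f \<longleftrightarrow> (\<forall>m\<in>Poly_Mapping.keys f. Poly_Mapping.keys m \<subseteq> A)"

lemma in_vars_add: "in_vars A f \<Longrightarrow> in_vars A g \<Longrightarrow> in_vars A (f + g)"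
  using Poly_Mapping.keys_add[of f g] by (auto simp: in_vars_def)

lemma in_vars_single: "Poly_Mapping.keys m \<subseteq> A \<Longrightarrow> in_vars A (Poly_Mapping.single m c)"
  by (auto simp: in_vars_def)

lemma in_vars_mult: "in_vars A f \<Longrightarrow> in_vars A g \<Longrightarrow> in_vars A (f * g)"
  unfolding in_vars_def by (blast dest: subsetD[OF keys_mult] subsetD[OF Poly_Mapping.keys_add])

lemma in_vars_uminus: "in_vars A f \<Longrightarrow> in_vars A (- f)"
  by (simp add: in_vars_def)

lemma in_vars_yvar: "j \<in> A \<Longrightarrow> in_vars A (yvar j)"
  unfolding yvar_def by (rule in_vars_single) simp

text \<open>The step multiplies by a single variable, which is the shape of the commutation
  relations of the algebra. Monomials are reached because a fresh exponent splits off as a power of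
  one variable.\<close>

lemma in_vars_induct [consumes 1, case_names const add var]:
  assumes "in_vars A f"
    and const: "\<And>c. P (Poly_Mapping.single 0 c)"
    and add: "\<And>f g. in_vars A f \<Longrightarrow> in_vars A g \<Longrightarrow> P f \<Longrightarrow> P g \<Longrightarrow> P (f + g)"
    and var: "\<And>j f. j \<in> A \<Longrightarrow> in_vars A f \<Longrightarrow> P f \<Longrightarrow> P (yvar j * f)"
  shows "P f"
proof -
  have pow: "in_vars A g \<and> P g \<Longrightarrow> j \<in> A \<Longrightarrow> in_vars A (yvar j ^ k * g) \<and> P (yvar j ^ k * g)" for j k g
    by (induction k) (auto simp: mult.assoc intro!: var in_vars_mult in_vars_yvar)
  have mon: "P (Poly_Mapping.single m c)" if "Poly_Mapping.keys m \<subseteq> A" for m c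
    using that
  proof (induction m rule: update_induct)
    case const
    then show ?case by (simp add: assms(2))
  next
    case (update m a b)
    then have keys: "a \<in> A" "Poly_Mapping.keys m \<subseteq> A" by (auto simp: keys_update)
    have "Poly_Mapping.single (Poly_Mapping.update a b m) c = yvar a ^ b * Poly_Mapping.single m c"
      using update by (simp add: single_plus_eq_update yvar_power mult_single)
    then show ?case
      using pow keys update.IH in_vars_single by metis
  qed
  show ?thesis
    using assms(1)
  proof (induction f rule: update_induct)
    case const
    then show ?case using assms(2)[of 0] by simp
  next
    case (update f m c)
    then have "Poly_Mapping.keys m \<subseteq> A" "in_vars A f" by (auto simp: in_vars_def keys_update)
    then show ?case
      using update by (simp add: single_plus_eq_update add mon in_vars_single)
  qed
qed

lemma polys_iff_in_vars: "f \<in> polys n \<longleftrightarrow> in_vars {1..n} f"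
  by (simp add: polys_def in_vars_def)

lemmas polys_induct [consumes 1, case_names const add var] =
  in_vars_induct[where A = "{1..n}" for n, folded polys_iff_in_vars]

lemmas polys_intros =
  in_vars_add[where A = "{1..n}" for n, folded polys_iff_in_vars]
  in_vars_mult[where A = "{1..n}" for n, folded polys_iff_in_vars]
  in_vars_uminus[where A = "{1..n}" for n, folded polys_iff_in_vars]
  in_vars_yvar[where A = "{1..n}" for n, folded polys_iff_in_vars]

lemma polys_const: "Poly_Mapping.single 0 c \<in> polys n"
  by (simp add: polys_def)

lemma polys_zero: "0 \<in> polys n"
  by (simp add: polys_def)

section \<open>Substitution homomorphisms on polynomials\<close>

lemma act_poly_superset:
  assumes "finite A" "Poly_Mapping.keys f \<subseteq> A"
  shows "act_poly \<sigma> f = (\<Sum>m\<in>A. Poly_Mapping.single 0 (Poly_Mapping.lookup f m)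
      * (\<Prod>j\<in>Poly_Mapping.keys m. \<sigma> j ^ Poly_Mapping.lookup m j))"
  unfolding act_poly_def by (rule sum.mono_neutral_left) (use assms in \<open>auto simp: in_keys_iff\<close>)

text \<open>Terms may cancel in f + g, so the three sums are compared over the union of the two
  supports.\<close>

lemma act_poly_add: "act_poly \<sigma> (f + g) = act_poly \<sigma> f + act_poly \<sigma> g"
proof -
  let ?A = "Poly_Mapping.keys f \<union> Poly_Mapping.keys g"
  have "finite ?A" "Poly_Mapping.keys f \<subseteq> ?A" "Poly_Mapping.keys g \<subseteq> ?A"
    "Poly_Mapping.keys (f + g) \<subseteq> ?A" by (auto dest: subsetD[OF Poly_Mapping.keys_add])
  then show ?thesis
    by (simp add: act_poly_superset[of ?A] lookup_add single_add distrib_right sum.distrib)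
qed

lemma act_poly_single:
  "act_poly \<sigma> (Poly_Mapping.single m c) = Poly_Mapping.single 0 c
      * (\<Prod>j\<in>Poly_Mapping.keys m. \<sigma> j ^ Poly_Mapping.lookup m j)"
  by (simp add: act_poly_superset[of "{m}"])

lemma act_poly_const [simp]: "act_poly \<sigma> (Poly_Mapping.single 0 c) = Poly_Mapping.single 0 c"
  by (simp add: act_poly_single)

lemma act_poly_zero [simp]: "act_poly \<sigma> 0 = 0"
  by (simp add: act_poly_def)

lemma act_poly_uminus: "act_poly \<sigma> (- f) = - act_poly \<sigma> f"
  using act_poly_add[of \<sigma> f "- f"] by (simp add: eq_neg_iff_add_eq_0 add.commute)

lemma act_poly_yvar [simp]: "act_poly \<sigma> (yvar j) = \<sigma> j"
  by (simp add: yvar_def act_poly_single)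

lemma act_poly_const_mult:
  "act_poly \<sigma> (Poly_Mapping.single 0 c * f) = Poly_Mapping.single 0 c * act_poly \<sigma> f"
proof (induction f rule: poly_mapping_single_induct)
  case (add m d f)
  have "Poly_Mapping.single 0 (c * d) = Poly_Mapping.single 0 c * (Poly_Mapping.single 0 d :: cpoly)"
    by (simp add: mult_single)
  with add show ?case
    by (simp add: distrib_left act_poly_add act_poly_single mult_single algebra_simps)
qed simp

text \<open>Multiplication by y_j may add the key j to a monomial, so all products are extended to
  \<open>insert j (keys m)\<close>, where exponents simply add.\<close>

lemma act_poly_yvar_mult: "act_poly \<sigma> (yvar j * f) = \<sigma> j * act_poly \<sigma> f"
proof (induction f rule: poly_mapping_single_induct)
  case (add m c f)
  let ?e = "Poly_Mapping.single j (1::nat)"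
  let ?A = "insert j (Poly_Mapping.keys m)"
  have "(\<Prod>k\<in>Poly_Mapping.keys (?e + m). \<sigma> k ^ Poly_Mapping.lookup (?e + m) k)
      = (\<Prod>k\<in>?A. \<sigma> k ^ Poly_Mapping.lookup (?e + m) k)"
    by (rule prod.mono_neutral_left) (auto simp: in_keys_iff lookup_add lookup_single when_def split: if_splits)
  also have "\<dots> = (\<Prod>k\<in>?A. \<sigma> k ^ Poly_Mapping.lookup ?e k) * (\<Prod>k\<in>?A. \<sigma> k ^ Poly_Mapping.lookup m k)"
    by (simp only: lookup_add power_add prod.distrib)
  also have "(\<Prod>k\<in>?A. \<sigma> k ^ Poly_Mapping.lookup ?e k) = (\<Prod>k\<in>{j}. \<sigma> k ^ Poly_Mapping.lookup ?e k)"
    by (rule prod.mono_neutral_right) (auto simp: lookup_single when_def)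
  also have "(\<Prod>k\<in>?A. \<sigma> k ^ Poly_Mapping.lookup m k)
      = (\<Prod>k\<in>Poly_Mapping.keys m. \<sigma> k ^ Poly_Mapping.lookup m k)"
    by (rule prod.mono_neutral_right) (auto simp: in_keys_iff)
  finally show ?case
    using add by (simp add: distrib_left act_poly_add act_poly_single yvar_mult_single algebra_simps)
qed simp

lemma act_poly_mult: "act_poly \<sigma> (f * g) = act_poly \<sigma> f * act_poly \<sigma> g"
proof -
  have "in_vars UNIV f" by (simp add: in_vars_def)
  then show ?thesis
    by (induction f rule: in_vars_induct)
      (simp_all add: act_poly_const_mult act_poly_yvar_mult distrib_right act_poly_add mult.assoc)
qed

lemma act_poly_act_poly: "act_poly \<sigma> (act_poly \<tau> f) = act_poly (\<lambda>j. act_poly \<sigma> (\<tau> j)) f"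
proof -
  have "in_vars UNIV f" by (simp add: in_vars_def)
  then show ?thesis
    by (induction f rule: in_vars_induct) (simp_all add: act_poly_add act_poly_mult)
qed

lemma act_poly_polys:
  assumes "\<And>j. j \<in> {1..n} \<Longrightarrow> \<sigma> j \<in> polys n" "f \<in> polys n"
  shows "act_poly \<sigma> f \<in> polys n"
  using assms(2)
  by (induction f rule: polys_induct)
    (simp_all add: act_poly_add act_poly_mult polys_const polys_intros assms(1))

section \<open>Exact division and the twisted Leibniz rule\<close>

lemma pquot_eqI: "g * q = p \<Longrightarrow> q \<noteq> 0 \<Longrightarrow> pquot p q = g"
  unfolding pquot_def by (rule the_equality) auto

text \<open>Keeping \<sigma> and \<open>q\<close> as parameters lets the three kinds of reflection
  share one calculus.\<close>

definition divdiff :: "(nat \<Rightarrow> cpoly) \<Rightarrow> cpoly \<Rightarrow> cpoly \<Rightarrow> cpoly" where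
  "divdiff \<sigma> q f = pquot (f - act_poly \<sigma> f) q"

text \<open>The divided difference by \<open>q\<close> sends \<open>y\<^sub>j\<close> to the constant \<open>\<delta> j\<close>.\<close>

definition divides_moves :: "nat \<Rightarrow> (nat \<Rightarrow> cpoly) \<Rightarrow> cpoly \<Rightarrow> (nat \<Rightarrow> complex) \<Rightarrow> bool" where
  "divides_moves n \<sigma> q \<delta> \<longleftrightarrow> q \<noteq> 0
     \<and> (\<forall>j\<in>{1..n}. \<sigma> j \<in> polys n \<and> Poly_Mapping.single 0 (\<delta> j) * q = yvar j - \<sigma> j)"

text \<open>\<open>pquot\<close> is a definite description, so an exact quotient has to be
  exhibited. The induction builds it by the Leibniz rule, which also keeps it in
  \<open>polys n\<close>.\<close>

lemma divdiff_polys_and_mult: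
  assumes q: "divides_moves n \<sigma> q \<delta>" and "f \<in> polys n"
  shows "divdiff \<sigma> q f \<in> polys n \<and> divdiff \<sigma> q f * q = f - act_poly \<sigma> f"
proof -
  have "\<exists>g\<in>polys n. g * q = f - act_poly \<sigma> f"
    using assms(2)
  proof (induction f rule: polys_induct)
    case (const c)
    then show ?case by (intro bexI[of _ 0]) (simp_all add: polys_zero)
  next
    case (add f g)
    then obtain a b where "a \<in> polys n" "b \<in> polys n" "a * q = f - act_poly \<sigma> f" "b * q = g - act_poly \<sigma> g"
      by blast
    then show ?case
      by (intro bexI[of _ "a + b"]) (simp_all add: polys_intros distrib_right act_poly_add)
  next
    case (var j f)
    let ?d = "Poly_Mapping.single 0 (\<delta> j) :: cpoly"
    from var obtain a where a: "a \<in> polys n" "a * q = f - act_poly \<sigma> f" by blast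
    have d: "?d * q = yvar j - \<sigma> j" "act_poly \<sigma> f \<in> polys n"
      using q var act_poly_polys[of n \<sigma>] by (auto simp: divides_moves_def)
    \<comment> \<open>The witness comes from splitting y_j f - (y_j f)^\<sigma> into y_j (f -
      f^\<sigma>) + (y_j - \<sigma> j) f^\<sigma>, both parts being multiples of
      \<open>q\<close>.\<close>
    have "(yvar j * a + ?d * act_poly \<sigma> f) * q = yvar j * (a * q) + (?d * q) * act_poly \<sigma> f"
      by (simp add: algebra_simps)
    also have "\<dots> = yvar j * f - act_poly \<sigma> (yvar j * f)"
      unfolding a d act_poly_mult act_poly_yvar by (simp add: algebra_simps)
    finally show ?case
      using a d var by (intro bexI[of _ "yvar j * a + ?d * act_poly \<sigma> f"]) (auto intro!: polys_intros polys_const)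
  qed
  then show ?thesis
    using pquot_eqI q by (metis divdiff_def divides_moves_def)
qed

lemmas divdiff_polys = divdiff_polys_and_mult[THEN conjunct1]
lemmas divdiff_mult = divdiff_polys_and_mult[THEN conjunct2]

lemma divdiff_eqI:
  assumes "divides_moves n \<sigma> q \<delta>" "g * q = f - act_poly \<sigma> f"
  shows "divdiff \<sigma> q f = g"
  using assms by (simp add: divdiff_def divides_moves_def pquot_eqI)

lemma divdiff_const: "divides_moves n \<sigma> q \<delta> \<Longrightarrow> divdiff \<sigma> q (Poly_Mapping.single 0 c) = 0"
  by (rule divdiff_eqI) simp_all

lemma divdiff_add:
  assumes "divides_moves n \<sigma> q \<delta>" "f \<in> polys n" "g \<in> polys n"
  shows "divdiff \<sigma> q (f + g) = divdiff \<sigma> q f + divdiff \<sigma> q g"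
  by (rule divdiff_eqI[OF assms(1)])
    (simp add: distrib_right divdiff_mult[OF assms(1)] assms(2,3) act_poly_add)

lemma divdiff_yvar_mult:
  assumes "divides_moves n \<sigma> q \<delta>" "f \<in> polys n" "j \<in> {1..n}"
  shows "divdiff \<sigma> q (yvar j * f) = yvar j * divdiff \<sigma> q f + Poly_Mapping.single 0 (\<delta> j) * act_poly \<sigma> f"
proof (rule divdiff_eqI[OF assms(1)])
  let ?d = "Poly_Mapping.single 0 (\<delta> j) :: cpoly"
  have "(yvar j * divdiff \<sigma> q f + ?d * act_poly \<sigma> f) * q
      = yvar j * (divdiff \<sigma> q f * q) + (?d * q) * act_poly \<sigma> f"
    by (simp add: algebra_simps)
  also have "\<dots> = yvar j * f - act_poly \<sigma> (yvar j * f)"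
  proof -
    have "divdiff \<sigma> q f * q = f - act_poly \<sigma> f" "?d * q = yvar j - \<sigma> j"
      using divdiff_mult[OF assms(1,2)] assms by (simp_all add: divides_moves_def)
    then show ?thesis by (simp only: act_poly_mult act_poly_yvar) (simp add: algebra_simps)
  qed
  finally show "(yvar j * divdiff \<sigma> q f + ?d * act_poly \<sigma> f) * q = yvar j * f - act_poly \<sigma> (yvar j * f)" .
qed

lemma lookup_yvar: "Poly_Mapping.lookup (yvar j) (Poly_Mapping.single k 1) = (if k = j then 1 else 0)"
  by (auto simp: yvar_def lookup_single when_def dest: arg_cong[of _ _ Poly_Mapping.keys])

lemma divides_moves_swap:
  assumes "i \<in> {1..n}" "k \<in> {1..n}" "k \<noteq> i"
  shows "divides_moves n (swap k i) (yvar i - yvar k) (\<lambda>j. if j = i then 1 else if j = k then - 1 else 0)"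
proof -
  have "Poly_Mapping.lookup (yvar i - yvar k) (Poly_Mapping.single i 1) \<noteq> 0"
    using assms lookup_yvar[of i i] lookup_yvar[of k i] by (simp add: lookup_minus)
  then have "yvar i - yvar k \<noteq> 0" by (metis lookup_zero)
  then show ?thesis
    using assms by (auto simp: divides_moves_def swap_def single_uminus intro!: polys_intros)
qed

lemma divides_moves_neg_swap:
  assumes "i \<in> {1..n}" "k \<in> {1..n}" "k \<noteq> i"
  shows "divides_moves n (neg_swap k i) (yvar i + yvar k) (\<lambda>j. if j = i \<or> j = k then 1 else 0)"
proof -
  have "Poly_Mapping.lookup (yvar i + yvar k) (Poly_Mapping.single i 1) \<noteq> 0"
    using assms lookup_yvar[of i i] lookup_yvar[of k i] by (simp add: lookup_add)
  then have "yvar i + yvar k \<noteq> 0" by (metis lookup_zero)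
  then show ?thesis
    using assms by (auto simp: divides_moves_def neg_swap_def single_uminus intro!: polys_intros)
qed

text \<open>Since y_i - (-y_i) = 2 y_i, the factor 2 in the denominator is what normalises the
  constant to 1.\<close>

lemma divides_moves_neg_at:
  assumes "i \<in> {1..n}"
  shows "divides_moves n (neg_at i) (2 * yvar i) (\<lambda>j. if j = i then 1 else 0)"
proof -
  have "yvar i \<noteq> 0" using lookup_yvar[of i i] by (metis lookup_zero zero_neq_one)
  then have "2 * yvar i \<noteq> 0" by simp
  then show ?thesis
    using assms by (auto simp: divides_moves_def neg_at_def intro!: polys_intros)
qed

section \<open>The induced module\<close>

lemma scal_mult_commute: "scal c * p = p * scal c"
  unfolding scal_def
  by (induction p rule: poly_mapping_single_induct) (simp_all add: distrib_left distrib_right mult_single mult.commute)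

lemma scal_one: "scal 1 = 1" and scal_minus_one: "scal (- 1) = - 1"
  by (simp_all add: scal_def flip: single_one single_uminus)

lemma free_algebra_mono:
  "G \<subseteq> G' \<Longrightarrow> p \<in> carrier (free_algebra G) \<Longrightarrow> p \<in> carrier (free_algebra G')"
  by (auto simp: free_algebra_carrier)

lemma ring_hom_presented:
  assumes "R \<subseteq> carrier (free_algebra G)"
  shows "cls G R \<in> ring_hom (free_algebra G) (presented G R)"
  unfolding presented_def cls_def rel_ideal_def
  by (intro ideal.rcos_ring_hom ring.genideal_ideal ring_free_algebra assms)

lemma cls_eq_of_rel:
  assumes "R \<subseteq> carrier (free_algebra G)" "p - q \<in> R" "q \<in> carrier (free_algebra G)"
  shows "cls G R p = cls G R q"
proof -
  interpret ideal "rel_ideal G R" "free_algebra G"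
    unfolding rel_ideal_def by (intro ring.genideal_ideal ring_free_algebra assms)
  have "p - q \<in> rel_ideal G R"
    using ring.genideal_self[OF ring_free_algebra assms(1)] assms(2) by (auto simp: rel_ideal_def)
  then have "(p - q) \<oplus>\<^bsub>free_algebra G\<^esub> q \<in> rel_ideal G R +>\<^bsub>free_algebra G\<^esub> q"
    by (auto simp: a_r_coset_def' intro!: bexI[of _ "p - q"])
  then show ?thesis
    unfolding cls_def using a_repr_independence[OF _ assms(3) a_subgroup] by simp
qed

lemma poly_tensor_add: "z \<in> poly_tensor n \<Longrightarrow> w \<in> poly_tensor n \<Longrightarrow> z + w \<in> poly_tensor n"
  using Poly_Mapping.keys_add[of z w] by (auto simp: poly_tensor_def)

lemma poly_tensor_diff:
  "z \<in> poly_tensor n \<Longrightarrow> w \<in> poly_tensor n \<Longrightarrow> z - w \<in> poly_tensor n"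
  for z w :: "(nat \<Rightarrow>\<^sub>0 nat) \<Rightarrow>\<^sub>0 'v::ab_group_add"
proof -
  have "Poly_Mapping.keys (- w) = Poly_Mapping.keys w" by (auto simp: in_keys_iff)
  then show "z \<in> poly_tensor n \<Longrightarrow> w \<in> poly_tensor n \<Longrightarrow> z - w \<in> poly_tensor n"
    using poly_tensor_add[of z n "- w"] by (simp add: poly_tensor_def)
qed

lemma poly_tensor_sum:
  "(\<And>k. k \<in> K \<Longrightarrow> z k \<in> poly_tensor n) \<Longrightarrow> sum z K \<in> poly_tensor n"
  for z :: "'k \<Rightarrow> (nat \<Rightarrow>\<^sub>0 nat) \<Rightarrow>\<^sub>0 'v::comm_monoid_add"
  by (induction K rule: infinite_finite_induct) (auto simp: poly_tensor_add, auto simp: poly_tensor_def)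

text \<open>Unbarred brackets grow by conjugation at the upper end of their products, barred
  elements at the lower end, so recursions at both ends are provided.\<close>

lemma t_up_Suc: "i \<le> Suc k \<Longrightarrow> t_up i (Suc k) = t_up i k * t_gen (Suc k)"
  by (simp add: t_up_def)

lemma t_down_Suc: "i \<le> Suc k \<Longrightarrow> t_down (Suc k) i = t_gen (Suc k) * t_down k i"
  by (simp add: t_down_def)

lemma t_up_rec: "i \<le> k \<Longrightarrow> t_up i k = t_gen i * t_up (Suc i) k"
  by (simp add: t_up_def upt_conv_Cons del: upt_Suc)

lemma t_down_rec: "i \<le> k \<Longrightarrow> t_down k i = t_down k (Suc i) * t_gen i"
  by (simp add: t_down_def upt_conv_Cons del: upt_Suc)

lemma t_up_empty: "k < i \<Longrightarrow> t_up i k = 1"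
  by (simp add: t_up_def)

lemma t_down_empty: "k < i \<Longrightarrow> t_down k i = 1"
  by (simp add: t_down_def)

locale spin_induction = spin_module scale n rho
  for scale :: "complex \<Rightarrow> 'v::ab_group_add \<Rightarrow> 'v" and n rho +
  fixes u v :: complex
  assumes n2: "n \<ge> 2"
begin

lemma lookup_ptens: "Poly_Mapping.lookup (ptens scale f x) m = scale (Poly_Mapping.lookup f m) x"
  by (auto simp: ptens_def Poly_Mapping.map.rep_eq when_def)

lemma lookup_tscale: "Poly_Mapping.lookup (tscale scale c z) m = scale c (Poly_Mapping.lookup z m)"
  by (auto simp: tscale_def Poly_Mapping.map.rep_eq when_def)

lemma ptens_add: "ptens scale (f + g) x = ptens scale f x + ptens scale g x"
  by (rule poly_mapping_eqI) (simp add: lookup_ptens lookup_add scale_left_distrib)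

lemma ptens_uminus: "ptens scale (- f) x = - ptens scale f x"
  by (rule poly_mapping_eqI) (simp add: lookup_ptens)

lemma ptens_uminus_right: "ptens scale f (- x) = - ptens scale f x"
  by (rule poly_mapping_eqI) (simp add: lookup_ptens)

lemma ptens_zero: "ptens scale 0 x = 0"
  by (rule poly_mapping_eqI) (simp add: lookup_ptens)

lemma ptens_single: "ptens scale (Poly_Mapping.single m c) x = Poly_Mapping.single m (scale c x)"
  by (rule poly_mapping_eqI) (simp add: lookup_ptens lookup_single when_def)

abbreviation "DA \<equiv> carrier (free_algebra (daha_gens n))"
abbreviation "SA \<equiv> carrier (free_algebra (spin_gens n))"
abbreviation "H \<equiv> daha n u v"
abbreviation "cl \<equiv> daha_cls n u v"
abbreviation "P \<equiv> pair_group n u v :: ((falg set \<times> 'v) \<Rightarrow>\<^sub>0 int) monoid"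

sublocale H: ring H by (rule ring_daha[OF n2])

sublocale cl: ring_hom_ring "free_algebra (daha_gens n)" H cl
  by (intro ring_hom_ringI2 ring_free_algebra ring_daha daha_cls_hom n2)

lemma gens_DA: "j \<in> {1..n} \<Longrightarrow> t_gen j \<in> DA" "j \<in> {1..n} \<Longrightarrow> y_gen j \<in> DA" "j \<in> {1..n} \<Longrightarrow> xi_gen j \<in> DA"
  by (auto simp: t_gen_def y_gen_def xi_gen_def daha_gens_def intro!: free_algebra_gen)

lemma t_gen_SA: "j \<in> {1..n} \<Longrightarrow> t_gen j \<in> SA"
  by (auto simp: t_gen_def spin_gens_def intro!: free_algebra_gen)

lemma SA_DA: "p \<in> SA \<Longrightarrow> p \<in> DA"
  by (rule free_algebra_mono) (auto simp: spin_gens_def daha_gens_def)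

lemma ymonom_DA: "ymonom n m \<in> DA"
  unfolding ymonom_def by (rule free_algebra_prod_list) (auto intro!: free_algebra_power gens_DA)

lemmas DA_intros = free_algebra_add free_algebra_diff free_algebra_uminus free_algebra_mult free_algebra_power
  free_algebra_one free_algebra_scal free_algebra_sum gens_DA ymonom_DA

lemma cl_closed: "p \<in> DA \<Longrightarrow> cl p \<in> carrier H"
  by (rule cl.hom_closed)

lemma cl_add: "p \<in> DA \<Longrightarrow> q \<in> DA \<Longrightarrow> cl (p + q) = cl p \<oplus>\<^bsub>H\<^esub> cl q"
  using cl.hom_add[of p q] by simp

lemma cl_mult: "p \<in> DA \<Longrightarrow> q \<in> DA \<Longrightarrow> cl (p * q) = cl p \<otimes>\<^bsub>H\<^esub> cl q"
  using cl.hom_mult[of p q] by simp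

lemma cl_rel: "p - q \<in> daha_rels n u v \<Longrightarrow> q \<in> DA \<Longrightarrow> cl p = cl q"
  unfolding daha_cls_def by (rule cls_eq_of_rel[OF daha_rels_carrier[OF n2]])

lemma cl_mult_cong:
  "\<lbrakk>cl p = cl p'; cl q = cl q'; p \<in> DA; p' \<in> DA; q \<in> DA; q' \<in> DA\<rbrakk> \<Longrightarrow> cl (p * q) = cl (p' * q')"
  by (simp add: cl_mult)

text \<open>Writing the action on words rather than classes keeps it in step with \<open>T\<close>
  and \<open>L\<close>, which also take words.\<close>

definition rhoc :: "falg \<Rightarrow> 'v \<Rightarrow> 'v" where "rhoc p x = rho (spin_cls n p) x"

sublocale sp: ring_hom_ring "free_algebra (spin_gens n)" "spin_alg n" "spin_cls n"
proof -
  have R: "spin_rels n \<subseteq> carrier (free_algebra (spin_gens n))"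
    by (rule spin_rels_carrier[OF n2]) (simp add: spin_gens_def)
  show "ring_hom_ring (free_algebra (spin_gens n)) (spin_alg n) (spin_cls n)"
    unfolding spin_alg_def spin_cls_def
    by (intro ring_hom_ringI2 ring_free_algebra ring_hom_presented R)
      (simp add: presented_def rel_ideal_def ideal.quotient_is_ring ring.genideal_ideal ring_free_algebra R)
qed

lemma rhoc_scal: "rhoc (scal c) x = scale c x"
  by (simp add: rhoc_def rho_scal)

lemma rhoc_mult: "p \<in> SA \<Longrightarrow> q \<in> SA \<Longrightarrow> rhoc (p * q) x = rhoc p (rhoc q x)"
  using sp.hom_mult[of p q] by (simp add: rhoc_def rho_mult)

text \<open>The negative is read as multiplication by the scalar -1, whose action
  \<open>rho_scal\<close> prescribes.\<close>

lemma rhoc_uminus: "p \<in> SA \<Longrightarrow> rhoc (- p) x = - rhoc p x"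
  using rhoc_mult[of "scal (- 1)" p x] rhoc_scal[of "- 1" "rhoc p x"]
  by (simp add: scal_minus_one free_algebra_uminus free_algebra_one)

lemma rhoc_scale: "p \<in> SA \<Longrightarrow> rhoc p (scale c x) = scale c (rhoc p x)"
  using module_hom.scale[OF Vector_Spaces.linear.axioms(3)[OF rho_linear[OF sp.hom_closed]]] by (simp add: rhoc_def)

section \<open>The tensor product as a quotient of a free abelian group\<close>

definition N :: "((falg set \<times> 'v) \<Rightarrow>\<^sub>0 int) set" where "N = tensor_null n u v rho"

text \<open>Elements of the induced module are handled through representatives in the free abelian group:
  \<open>c \<doteq> d\<close> is equality in the tensor product, \<open>T p x\<close> stands for \<open>p \<otimes> x\<close>, \<open>L p\<close> for left multiplication by
  \<open>p\<close>, and \<open>J\<close> below for the canonical map from \<open>\<complex>[y\<^sub>1,\<dots>,y\<^sub>n] \<otimes> V\<close>.\<close>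

definition eqv :: "((falg set \<times> 'v) \<Rightarrow>\<^sub>0 int) \<Rightarrow> _ \<Rightarrow> bool" (infix \<open>\<doteq>\<close> 50) where "c \<doteq> d \<longleftrightarrow> c - d \<in> N"

definition T :: "falg \<Rightarrow> 'v \<Rightarrow> (falg set \<times> 'v) \<Rightarrow>\<^sub>0 int" where "T p x = frag_of (cl p, x)"

definition L :: "falg \<Rightarrow> ((falg set \<times> 'v) \<Rightarrow>\<^sub>0 int) \<Rightarrow> _" where
  "L p = frag_extend (\<lambda>(a, x). frag_of (cl p \<otimes>\<^bsub>H\<^esub> a, x))"

lemma xi_graph_closed: "xi_graph n u v rho h F \<Longrightarrow> h \<in> carrier H"
  by (induction rule: xi_graph.induct) (simp_all add: cl_closed gens_DA SA_DA)

lemma carrier_P: "c \<in> carrier P \<longleftrightarrow> Poly_Mapping.keys c \<subseteq> carrier H \<times> UNIV"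
  by (simp add: pair_group_def)

lemma P_diff: "c \<in> carrier P \<Longrightarrow> d \<in> carrier P \<Longrightarrow> c - d \<in> carrier P"
  using keys_diff[of c d] by (auto simp: carrier_P)

lemma P_zero: "0 \<in> carrier P"
  by (simp add: carrier_P)

lemma P_add: "c \<in> carrier P \<Longrightarrow> d \<in> carrier P \<Longrightarrow> c + d \<in> carrier P"
  using Poly_Mapping.keys_add[of c d] by (auto simp: carrier_P)

lemma P_sum: "(\<And>k. k \<in> K \<Longrightarrow> c k \<in> carrier P) \<Longrightarrow> sum c K \<in> carrier P"
  by (induction K rule: infinite_finite_induct) (auto intro: P_zero P_add)

lemma tensor_rels_P: "tensor_rels n u v rho \<subseteq> carrier P"
proof
  fix r :: "(falg set \<times> 'v) \<Rightarrow>\<^sub>0 int"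
  assume "r \<in> tensor_rels n u v rho"
  then show "r \<in> carrier P"
    unfolding tensor_rels_def by (auto intro!: P_diff dest: xi_graph_closed) (auto simp: carrier_P dest: xi_graph_closed)
qed

lemma group_P: "group P"
  by (simp add: pair_group_def)

lemma N_subgroup: "subgroup N P"
  unfolding N_def tensor_null_def by (rule group.generate_is_subgroup[OF group_P tensor_rels_P])

lemma N_P: "c \<in> N \<Longrightarrow> c \<in> carrier P"
  using subgroup.mem_carrier[OF N_subgroup] .

lemma N_zero: "0 \<in> N"
  using subgroup.one_closed[OF N_subgroup] by (simp add: pair_group_def)

lemma N_add: "c \<in> N \<Longrightarrow> d \<in> N \<Longrightarrow> c + d \<in> N"
  using subgroup.m_closed[OF N_subgroup, of c d] by (simp add: pair_group_def)

lemma N_uminus: "c \<in> N \<Longrightarrow> - c \<in> N"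
  using subgroup.m_inv_closed[OF N_subgroup, of c] N_P[of c]
  by (simp add: pair_group_def inv_free_Abelian_group)

lemma N_rel: "c \<in> tensor_rels n u v rho \<Longrightarrow> c \<in> N"
  by (simp add: N_def tensor_null_def generate.incl)

text \<open>Closure under differences covers both remaining cases of \<open>generate\<close>: an
  inverse is 0 - c and a sum is c - (0 - d).\<close>

lemma N_induct [consumes 1, case_names rel zero diff]:
  assumes "c \<in> N" "\<And>c. c \<in> tensor_rels n u v rho \<Longrightarrow> Q c" "Q 0" "\<And>c d. Q c \<Longrightarrow> Q d \<Longrightarrow> Q (c - d)"
  shows "Q c"
  using assms(1) unfolding N_def tensor_null_def
proof (induction rule: generate.induct)
  case one
  then show ?case using assms(3) by (simp add: pair_group_def)
next
  case (incl h)
  then show ?case by (rule assms(2))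
next
  case (inv h)
  then have "inv\<^bsub>P\<^esub> h = - h"
    using tensor_rels_P by (auto simp: pair_group_def subset_iff intro!: inv_free_Abelian_group)
  then show ?case using assms(4)[OF assms(3) assms(2)[OF inv]] by simp
next
  case (eng h1 h2)
  then have "Q (h1 - (0 - h2))" using assms(3,4) by blast
  then show ?case by (simp add: pair_group_def)
qed

lemma eqv_refl [simp, intro!]: "c \<doteq> c"
  by (simp add: eqv_def N_zero)

lemma eqv_sym: "c \<doteq> d \<Longrightarrow> d \<doteq> c"
  using N_uminus[of "c - d"] by (simp add: eqv_def)

lemma eqv_trans [trans]: "c \<doteq> d \<Longrightarrow> d \<doteq> e \<Longrightarrow> c \<doteq> e"
  using N_add[of "c - d" "d - e"] by (simp add: eqv_def)

lemma eqv_add: "c \<doteq> d \<Longrightarrow> c' \<doteq> d' \<Longrightarrow> c + c' \<doteq> d + d'"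
  using N_add[of "c - d" "c' - d'"] by (simp add: eqv_def algebra_simps)

lemma eqv_uminus: "c \<doteq> d \<Longrightarrow> - c \<doteq> - d"
  using N_uminus[of "c - d"] by (simp add: eqv_def)

lemma eqv_diff: "c \<doteq> d \<Longrightarrow> c' \<doteq> d' \<Longrightarrow> c - c' \<doteq> d - d'"
  using eqv_add[of c d "- c'" "- d'"] eqv_uminus[of c' d'] by simp

lemma eqv_sum: "(\<And>k. k \<in> K \<Longrightarrow> c k \<doteq> d k) \<Longrightarrow> sum c K \<doteq> sum d K"
  by (induction K rule: infinite_finite_induct) (auto intro: eqv_add)

lemma L_zero [simp]: "L p 0 = 0"
  by (simp add: L_def)

lemma L_add: "L p (c + d) = L p c + L p d"
  by (simp add: L_def frag_extend_add)

lemma L_diff: "L p (c - d) = L p c - L p d"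
  by (simp add: L_def frag_extend_diff)

lemma L_sum: "L p (sum c K) = (\<Sum>k\<in>K. L p (c k))"
  by (induction K rule: infinite_finite_induct) (simp_all add: L_add)

lemma L_T: "p \<in> DA \<Longrightarrow> q \<in> DA \<Longrightarrow> L p (T q x) = T (p * q) x"
  by (simp add: L_def T_def cl_mult)

lemma P_T: "p \<in> DA \<Longrightarrow> T p x \<in> carrier P"
  by (simp add: carrier_P T_def cl_closed)

lemma L_frag_of: "L p (frag_of (a, x)) = frag_of (cl p \<otimes>\<^bsub>H\<^esub> a, x)"
  by (simp add: L_def)

lemma P_induct [consumes 1, case_names zero one diff]:
  assumes "c \<in> carrier P" "Q 0" "\<And>a x. a \<in> carrier H \<Longrightarrow> Q (frag_of (a, x))"
    and "\<And>c d. c \<in> carrier P \<Longrightarrow> d \<in> carrier P \<Longrightarrow> Q c \<Longrightarrow> Q d \<Longrightarrow> Q (c - d)"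
  shows "Q c"
proof -
  have "Poly_Mapping.keys c \<subseteq> carrier H \<times> UNIV" using assms(1) by (simp add: carrier_P)
  then have "c \<in> carrier P \<and> Q c"
    by (induction c rule: frag_induction) (auto simp: P_zero P_diff assms, auto simp: carrier_P)
  then show ?thesis ..
qed

text \<open>An equality rather than a congruence, since associativity acts inside each basis
  element; membership in \<open>carrier P\<close> supplies the closure that associativity
  requires.\<close>

lemma L_mult: "c \<in> carrier P \<Longrightarrow> p \<in> DA \<Longrightarrow> q \<in> DA \<Longrightarrow> L (p * q) c = L p (L q c)"
proof (induction c rule: P_induct)
  case (one a x)
  then show ?case by (simp add: L_frag_of cl_mult cl_closed H.m_assoc)
qed (simp_all add: L_diff)

lemma frag_of_add: "a \<in> carrier H \<Longrightarrow> b \<in> carrier H \<Longrightarrow> frag_of (a \<oplus>\<^bsub>H\<^esub> b, x) \<doteq> frag_of (a, x) + frag_of (b, x)"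
  unfolding eqv_def diff_diff_eq[symmetric]
  by (rule N_rel, unfold tensor_rels_def, rule UnI1, rule UnI1, rule CollectI, (rule exI)+, rule conjI, rule refl, simp)

lemma frag_of_add_right: "a \<in> carrier H \<Longrightarrow> frag_of (a, x + x') \<doteq> frag_of (a, x) + frag_of (a, x')"
  unfolding eqv_def diff_diff_eq[symmetric]
  by (rule N_rel, unfold tensor_rels_def, rule UnI1, rule UnI2, rule CollectI, (rule exI)+, rule conjI, rule refl, simp)

lemma frag_of_balance: "a \<in> carrier H \<Longrightarrow> xi_graph n u v rho h F \<Longrightarrow> frag_of (a \<otimes>\<^bsub>H\<^esub> h, x) \<doteq> frag_of (a, F x)"
  unfolding eqv_def
  by (rule N_rel, unfold tensor_rels_def, rule UnI2, rule CollectI, (rule exI)+, rule conjI, rule refl, simp)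

text \<open>Only a congruence: the pair of a sum a + b with x is a basis element of its own, tied to
  the pairs of a and of b solely by the relations.\<close>

lemma L_plus: "c \<in> carrier P \<Longrightarrow> p \<in> DA \<Longrightarrow> q \<in> DA \<Longrightarrow> L (p + q) c \<doteq> L p c + L q c"
proof (induction c rule: P_induct)
  case (one a x)
  then show ?case by (simp add: L_frag_of cl_add cl_closed H.l_distr frag_of_add)
next
  case (diff c d)
  then have "L (p + q) c - L (p + q) d \<doteq> (L p c + L q c) - (L p d + L q d)"
    by (intro eqv_diff) auto
  then show ?case by (simp add: L_diff algebra_simps)
qed simp

text \<open>Left multiplication carries each family of tensor relations into itself: the additive
  ones by distributivity and additivity in the vector, the balancing one by associativity.\<close>

lemma L_cong:
  assumes "c \<doteq> d" "p \<in> DA"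
  shows "L p c \<doteq> L p d"
proof -
  have "L p r \<in> N" if "r \<in> N" for r
    using that
  proof (induction r rule: N_induct)
    case (rel r)
    have p: "cl p \<in> carrier H" using assms(2) by (rule cl_closed)
    from rel consider (1) a b x where "r = frag_of (a \<oplus>\<^bsub>H\<^esub> b, x) - frag_of (a, x) - frag_of (b, x)"
        "a \<in> carrier H" "b \<in> carrier H"
      | (2) a x x' where "r = frag_of (a, x + x') - frag_of (a, x) - frag_of (a, x')" "a \<in> carrier H"
      | (3) a h F x where "r = frag_of (a \<otimes>\<^bsub>H\<^esub> h, x) - frag_of (a, F x)" "a \<in> carrier H" "xi_graph n u v rho h F"
      unfolding tensor_rels_def by blast
    then show ?case
    proof cases
      case 1
      then show ?thesis
        using frag_of_add[of "cl p \<otimes>\<^bsub>H\<^esub> a" "cl p \<otimes>\<^bsub>H\<^esub> b" x] p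
        by (simp add: L_diff L_add L_frag_of H.r_distr eqv_def diff_diff_eq)
    next
      case 2
      then show ?thesis
        using frag_of_add_right[of "cl p \<otimes>\<^bsub>H\<^esub> a" x x'] p
        by (simp add: L_diff L_add L_frag_of eqv_def diff_diff_eq)
    next
      case 3
      then show ?thesis
        using frag_of_balance[of "cl p \<otimes>\<^bsub>H\<^esub> a" h F x] p xi_graph_closed[OF 3(3)]
        by (simp add: L_diff L_frag_of eqv_def H.m_assoc)
    qed
  next
    case (diff c d)
    then show ?case using N_add[of "L p c" "- L p d"] N_uminus[of "L p d"] by (simp add: L_diff)
  qed (simp add: N_zero)
  then show ?thesis using assms(1) by (simp add: eqv_def flip: L_diff)
qed

lemma ind_cls_cong:
  assumes "c \<doteq> d"
  shows "ind_cls n u v rho c = ind_cls n u v rho d"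
proof -
  have "ind_cls n u v rho c = {e. e \<doteq> c}" for c :: "(falg set \<times> 'v) \<Rightarrow>\<^sub>0 int"
    unfolding ind_cls_def N_def[symmetric] eqv_def
    by (force simp: r_coset_def pair_group_def)
  then show ?thesis using assms by (auto intro: eqv_trans eqv_sym)
qed

text \<open>\<open>ind_act\<close> is a union over all representatives of a coset. By
  \<open>L_cong\<close> they all contribute the same coset, so the union collapses.\<close>

lemma ind_act_ind_cls:
  assumes "p \<in> DA"
  shows "ind_act n u v rho (cl p) (ind_cls n u v rho c) = ind_cls n u v rho (L p c)"
proof -
  have "e \<doteq> c" if "e \<in> ind_cls n u v rho c" for e
    using that unfolding ind_cls_def N_def[symmetric] eqv_def
    by (auto simp: r_coset_def pair_group_def)
  moreover have "c \<in> ind_cls n u v rho c"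
    using N_zero unfolding ind_cls_def N_def[symmetric]
    by (force simp: r_coset_def pair_group_def)
  ultimately show ?thesis
    unfolding ind_act_def L_def[symmetric] using ind_cls_cong[OF L_cong[OF _ assms]] by blast
qed

text \<open>The pair of p with the zero vector is a nonzero basis element; additivity at 0 + 0 = 0
  puts its negative into \<open>N\<close>.\<close>

lemma T_zero: "p \<in> DA \<Longrightarrow> T p 0 \<doteq> 0"
  using frag_of_add_right[of "cl p" 0 0] cl_closed[of p] N_uminus[of "- T p 0"]
  by (simp add: T_def eqv_def)

lemma T_add_right: "p \<in> DA \<Longrightarrow> T p (x + x') \<doteq> T p x + T p x'"
  by (simp add: T_def frag_of_add_right cl_closed)

lemma T_rhoc: "p \<in> DA \<Longrightarrow> q \<in> SA \<Longrightarrow> T (p * q) x \<doteq> T p (rhoc q x)"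
  unfolding T_def rhoc_def using frag_of_balance[OF cl_closed xi_graph.spin, of p q x] by (simp add: cl_mult SA_DA)

lemma T_xi: "p \<in> DA \<Longrightarrow> i \<in> {1..n} \<Longrightarrow> T (p * xi_gen i) x \<doteq> 0"
proof -
  assume *: "p \<in> DA" "i \<in> {1..n}"
  then have "T (p * xi_gen i) x \<doteq> T p 0"
    unfolding T_def using frag_of_balance[OF cl_closed xi_graph.xi, of p i x] by (simp add: cl_mult gens_DA)
  also have "T p 0 \<doteq> 0" using * by (simp add: T_zero)
  finally show ?thesis .
qed

section \<open>The canonical map on representatives\<close>

definition J :: "((nat \<Rightarrow>\<^sub>0 nat) \<Rightarrow>\<^sub>0 'v) \<Rightarrow> (falg set \<times> 'v) \<Rightarrow>\<^sub>0 int" where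
  "J z = (\<Sum>m\<in>Poly_Mapping.keys z. T (ymonom n m) (Poly_Mapping.lookup z m))"

lemma ident_J: "ident n u v rho z = ind_cls n u v rho (J z)"
  by (simp add: ident_def J_def T_def)

lemma P_J: "J z \<in> carrier P"
  unfolding J_def by (intro P_sum P_T ymonom_DA)

text \<open>Padding the support adds terms with coefficient 0, which vanish only modulo
  \<open>N\<close>. This is what makes \<open>J\<close> additive when supports differ or terms
  cancel.\<close>

lemma J_superset:
  assumes "finite A" "Poly_Mapping.keys z \<subseteq> A"
  shows "J z \<doteq> (\<Sum>m\<in>A. T (ymonom n m) (Poly_Mapping.lookup z m))"
proof -
  let ?t = "\<lambda>m. T (ymonom n m) (Poly_Mapping.lookup z m)"
  have "(\<Sum>m\<in>A - Poly_Mapping.keys z. ?t m) \<doteq> (\<Sum>m\<in>A - Poly_Mapping.keys z. 0)"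
    by (rule eqv_sum) (simp add: in_keys_iff T_zero ymonom_DA)
  then have "(\<Sum>m\<in>A - Poly_Mapping.keys z. ?t m) + J z \<doteq> 0 + J z"
    by (intro eqv_add) simp_all
  then show ?thesis
    using assms by (simp add: J_def sum.subset_diff[of "Poly_Mapping.keys z" A] eqv_sym)
qed

lemma J_zero: "J 0 = 0"
  by (simp add: J_def)

lemma J_add: "J (z + w) \<doteq> J z + J w"
proof -
  let ?A = "Poly_Mapping.keys z \<union> Poly_Mapping.keys w"
  let ?t = "\<lambda>z m. T (ymonom n m) (Poly_Mapping.lookup z m)"
  have "J (z + w) \<doteq> sum (?t (z + w)) ?A"
    using Poly_Mapping.keys_add[of z w] by (intro J_superset) auto
  also have "sum (?t (z + w)) ?A \<doteq> (\<Sum>m\<in>?A. ?t z m + ?t w m)"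
    unfolding lookup_add by (intro eqv_sum T_add_right ymonom_DA)
  also have "(\<Sum>m\<in>?A. ?t z m + ?t w m) = sum (?t z) ?A + sum (?t w) ?A"
    by (rule sum.distrib)
  also have "\<dots> \<doteq> J z + J w"
    by (intro eqv_add eqv_sym[OF J_superset]) auto
  finally show ?thesis .
qed

lemma J_uminus: "J (- z) \<doteq> - J z"
proof -
  have "J (- z + z) - J z \<doteq> (J (- z) + J z) - J z" by (intro eqv_diff J_add eqv_refl)
  then show ?thesis by (simp add: J_zero eqv_sym)
qed

lemma J_diff: "J (z - w) \<doteq> J z - J w"
proof -
  have "J (z + - w) \<doteq> J z + J (- w)" by (rule J_add)
  also have "\<dots> \<doteq> J z + - J w" by (intro eqv_add J_uminus eqv_refl)
  finally show ?thesis by simp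
qed

lemma J_sum: "J (sum z K) \<doteq> (\<Sum>k\<in>K. J (z k))"
proof (induction K rule: infinite_finite_induct)
  case (insert k K)
  have "J (z k + sum z K) \<doteq> J (z k) + J (sum z K)" by (rule J_add)
  also have "\<dots> \<doteq> J (z k) + (\<Sum>k\<in>K. J (z k))" by (intro eqv_add insert eqv_refl)
  finally show ?case using insert by simp
qed (simp_all add: J_zero)

lemma J_single: "J (Poly_Mapping.single m x) \<doteq> T (ymonom n m) x"
  using J_superset[of "{m}" "Poly_Mapping.single m x"] by (simp split: if_splits)

text \<open>A scalar on the vector is moved across the tensor sign by balancing and then, being
  central, to the front of the monomial.\<close>

lemma J_tscale: "J (tscale scale c z) \<doteq> L (scal c) (J z)"
proof -
  let ?A = "Poly_Mapping.keys z"
  have "J (tscale scale c z) \<doteq> (\<Sum>m\<in>?A. T (ymonom n m) (Poly_Mapping.lookup (tscale scale c z) m))"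
    by (rule J_superset) (auto simp: in_keys_iff lookup_tscale)
  also have "\<dots> = (\<Sum>m\<in>?A. T (ymonom n m) (rhoc (scal c) (Poly_Mapping.lookup z m)))"
    by (simp add: lookup_tscale rhoc_scal)
  also have "\<dots> \<doteq> (\<Sum>m\<in>?A. T (ymonom n m * scal c) (Poly_Mapping.lookup z m))"
    by (intro eqv_sum eqv_sym[OF T_rhoc] DA_intros)
  also have "\<dots> = L (scal c) (J z)"
    by (simp add: J_def L_sum L_T DA_intros scal_mult_commute)
  finally show ?thesis .
qed

section \<open>Ordered monomials and multiplication by a variable\<close>

lemma y_comm:
  assumes "i \<in> {1..n}" "j \<in> {1..n}"
  shows "cl (y_gen i * y_gen j) = cl (y_gen j * y_gen i)"
  by (rule cl_rel) (use assms in \<open>auto simp: daha_rels_def intro!: DA_intros\<close>)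

lemma y_power_comm:
  assumes "i \<in> {1..n}" "j \<in> {1..n}"
  shows "cl (y_gen i * y_gen j ^ k) = cl (y_gen j ^ k * y_gen i)"
proof (induction k)
  case (Suc k)
  have "cl (y_gen i * y_gen j ^ Suc k) = cl ((y_gen i * y_gen j) * y_gen j ^ k)"
    by (simp add: mult.assoc)
  also have "\<dots> = cl ((y_gen j * y_gen i) * y_gen j ^ k)"
    by (intro cl_mult_cong y_comm assms DA_intros refl)
  also have "\<dots> = cl (y_gen j * (y_gen i * y_gen j ^ k))"
    by (simp add: mult.assoc)
  also have "\<dots> = cl (y_gen j * (y_gen j ^ k * y_gen i))"
    by (intro cl_mult_cong Suc assms DA_intros refl)
  finally show ?case by (simp add: mult.assoc)
qed simp

text \<open>The part of \<open>ymonom n m\<close> in the first \<open>k\<close> variables, to allow induction on \<open>k\<close> with \<open>n\<close> fixed.\<close>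

definition ypart :: "(nat \<Rightarrow>\<^sub>0 nat) \<Rightarrow> nat \<Rightarrow> falg" where
  "ypart m k = prod_list (map (\<lambda>j. y_gen j ^ Poly_Mapping.lookup m j) [1..<Suc k])"

lemma ypart_Suc: "ypart m (Suc k) = ypart m k * y_gen (Suc k) ^ Poly_Mapping.lookup m (Suc k)"
  by (simp add: ypart_def)

lemma ypart_DA: "k \<le> n \<Longrightarrow> ypart m k \<in> DA"
  unfolding ypart_def by (rule free_algebra_prod_list) (auto intro!: free_algebra_power gens_DA)

lemma y_ypart_comm:
  assumes "j \<in> {1..n}" "k \<le> n"
  shows "cl (y_gen j * ypart m k) = cl (ypart m k * y_gen j)"
  using assms(2)
proof (induction k)
  case 0
  then show ?case by (simp add: ypart_def)
next
  case (Suc k)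
  let ?y = "y_gen (Suc k) ^ Poly_Mapping.lookup m (Suc k)"
  have D: "y_gen j \<in> DA" "ypart m k \<in> DA" "?y \<in> DA"
    using Suc.prems assms by (auto intro!: DA_intros ypart_DA)
  have "cl (y_gen j * ypart m k * ?y) = cl (ypart m k * y_gen j * ?y)"
    using Suc by (intro cl_mult_cong[OF _ refl] DA_intros D) simp
  also have "\<dots> = cl (ypart m k * (y_gen j * ?y))" by (simp add: mult.assoc)
  also have "\<dots> = cl (ypart m k * (?y * y_gen j))"
    using Suc.prems assms by (intro cl_mult_cong[OF refl] y_power_comm DA_intros D) auto
  finally show ?case by (simp add: ypart_Suc mult.assoc)
qed

text \<open>The factors of a monomial are ordered by index. The new y_j is moved past the variables
  of smaller index until it joins the power of y_j; the later factors are unaffected.\<close>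

lemma y_ypart:
  assumes "1 \<le> j" "k \<le> n" "j \<le> k"
  shows "cl (y_gen j * ypart m k) = cl (ypart (Poly_Mapping.single j 1 + m) k)"
  using assms(2,3)
proof (induction k)
  case 0
  then show ?case using assms(1) by simp
next
  case (Suc k)
  let ?y = "\<lambda>m. y_gen (Suc k) ^ Poly_Mapping.lookup m (Suc k)"
  let ?m = "Poly_Mapping.single j 1 + m"
  have D: "y_gen j \<in> DA" "ypart m k \<in> DA" "ypart ?m k \<in> DA" "?y m \<in> DA"
    using Suc.prems assms(1) by (auto intro!: DA_intros ypart_DA)
  show ?case
  proof (cases "j = Suc k")
    case True
    have "cl (y_gen j * ypart m k * ?y m) = cl (ypart m k * y_gen j * ?y m)"
      using Suc.prems assms(1) by (intro cl_mult_cong refl y_ypart_comm DA_intros D) auto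
    moreover have "ypart ?m k = ypart m k"
      unfolding ypart_def using True
      by (intro arg_cong[of _ _ prod_list] map_cong) (auto simp: lookup_add lookup_single when_def)
    ultimately show ?thesis
      using True by (simp add: ypart_Suc mult.assoc lookup_add)
  next
    case False
    have "cl (y_gen j * ypart m k * ?y m) = cl (ypart ?m k * ?y m)"
      using Suc False by (intro cl_mult_cong refl DA_intros D) auto
    then show ?thesis
      using False by (simp add: ypart_Suc mult.assoc lookup_add lookup_single)
  qed
qed

lemma y_ymonom: "j \<in> {1..n} \<Longrightarrow> cl (y_gen j * ymonom n m) = cl (ymonom n (Poly_Mapping.single j 1 + m))"
  using y_ypart[of j n m] by (simp add: ypart_def ymonom_def)

lemma J_yvar_mult:
  assumes "j \<in> {1..n}"
  shows "J (ptens scale (yvar j * f) x) \<doteq> L (y_gen j) (J (ptens scale f x))"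
proof (induction f rule: poly_mapping_single_induct)
  case zero
  then show ?case by (simp add: ptens_zero J_zero)
next
  case (add m c f)
  let ?x = "scale c x" and ?m = "Poly_Mapping.single j 1 + m"
  have "J (ptens scale (yvar j * (Poly_Mapping.single m c + f)) x)
      = J (Poly_Mapping.single ?m ?x + ptens scale (yvar j * f) x)"
    by (simp add: distrib_left yvar_mult_single ptens_add ptens_single)
  also have "\<dots> \<doteq> J (Poly_Mapping.single ?m ?x) + J (ptens scale (yvar j * f) x)"
    by (rule J_add)
  also have "\<dots> \<doteq> T (ymonom n ?m) ?x + L (y_gen j) (J (ptens scale f x))"
    by (intro eqv_add J_single add)
  also have "\<dots> = L (y_gen j) (T (ymonom n m) ?x + J (ptens scale f x))"
    using assms y_ymonom[OF assms, of m] by (simp add: L_add L_T DA_intros) (simp add: T_def)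
  also have "\<dots> \<doteq> L (y_gen j) (J (Poly_Mapping.single m ?x) + J (ptens scale f x))"
    by (intro L_cong eqv_add eqv_sym[OF J_single] eqv_refl gens_DA assms)
  also have "\<dots> \<doteq> L (y_gen j) (J (ptens scale (Poly_Mapping.single m c + f) x))"
    unfolding ptens_add ptens_single
    by (intro L_cong eqv_sym[OF J_add] gens_DA assms)
  finally show ?case .
qed

section \<open>Brackets act through reflections\<close>

lemma L_cl_cong: "cl p = cl q \<Longrightarrow> L p = L q"
  by (simp add: L_def)

lemma L_zero_left: "c \<in> carrier P \<Longrightarrow> L 0 c \<doteq> 0"
proof -
  assume "c \<in> carrier P"
  then have "L (0 + 0) c - L 0 c \<doteq> L 0 c + L 0 c - L 0 c"
    by (intro eqv_diff L_plus eqv_refl free_algebra_zero)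
  then show ?thesis by (simp add: eqv_sym)
qed

lemma L_uminus_left:
  assumes "c \<in> carrier P" "p \<in> DA"
  shows "L (- p) c \<doteq> - L p c"
proof -
  have "L (- p) c + L p c \<doteq> L (- p + p) c"
    using assms by (intro eqv_sym[OF L_plus] free_algebra_uminus)
  also have "\<dots> \<doteq> 0" using assms by (simp add: L_zero_left)
  finally have "L (- p) c + L p c - L p c \<doteq> 0 - L p c" by (rule eqv_diff) simp
  then show ?thesis by simp
qed

lemma L_minus_left:
  assumes "c \<in> carrier P" "p \<in> DA" "q \<in> DA"
  shows "L (p - q) c \<doteq> L p c - L q c"
proof -
  have "L (p + - q) c \<doteq> L p c + L (- q) c"
    using assms by (intro L_plus free_algebra_uminus)
  also have "\<dots> \<doteq> L p c + - L q c"
    using assms by (intro eqv_add L_uminus_left eqv_refl)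
  finally show ?thesis by simp
qed

lemma L_sum_left:
  assumes "c \<in> carrier P" "\<And>k. k \<in> K \<Longrightarrow> p k \<in> DA"
  shows "L (sum p K) c \<doteq> (\<Sum>k\<in>K. L (p k) c)"
  using assms(2)
proof (induction K rule: infinite_finite_induct)
  case (insert k K)
  have "L (p k + sum p K) c \<doteq> L (p k) c + L (sum p K) c"
    using insert assms(1) by (intro L_plus free_algebra_sum) auto
  also have "\<dots> \<doteq> L (p k) c + (\<Sum>k\<in>K. L (p k) c)"
    using insert by (intro eqv_add eqv_refl) auto
  finally show ?case using insert by simp
qed (simp_all add: L_zero_left assms(1))

abbreviation pt :: "cpoly \<Rightarrow> 'v \<Rightarrow> _" where "pt f x \<equiv> J (ptens scale f x)"

lemmas ptens_simps = ptens_add ptens_uminus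
  ptens_uminus_right ptens_zero ptens_single

text \<open>Stability of \<open>polys n\<close> under \<sigma> is bundled in so that the property
  composes under products.\<close>

definition intertwines :: "falg \<Rightarrow> (nat \<Rightarrow> cpoly) \<Rightarrow> bool" where
  "intertwines p \<sigma> \<longleftrightarrow> p \<in> SA \<and> (\<forall>j\<in>{1..n}. \<sigma> j \<in> polys n)
     \<and> (\<forall>f\<in>polys n. \<forall>x. L p (pt f x) \<doteq> pt (act_poly \<sigma> f) (rhoc p x))"

lemma intertwinesD:
  "intertwines p \<sigma> \<Longrightarrow> p \<in> SA" "intertwines p \<sigma> \<Longrightarrow> j \<in> {1..n} \<Longrightarrow> \<sigma> j \<in> polys n"
  "intertwines p \<sigma> \<Longrightarrow> f \<in> polys n \<Longrightarrow> L p (pt f x) \<doteq> pt (act_poly \<sigma> f) (rhoc p x)"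
  by (auto simp: intertwines_def)

text \<open>The element p moves past one variable at a time until it meets a constant, where
  balancing hands it to the vector. The signed alternative accommodates t_n.\<close>

lemma intertwines_of_commutation:
  assumes p: "p \<in> SA"
    and comm: "\<And>j. j \<in> {1..n} \<Longrightarrow> \<exists>k\<in>{1..n}.
      \<sigma> j = yvar k \<and> cl (p * y_gen j) = cl (y_gen k * p)
      \<or> \<sigma> j = - yvar k \<and> cl (p * y_gen j) = cl (- (y_gen k * p))"
  shows "intertwines p \<sigma>"
proof -
  have pD: "p \<in> DA" using p by (rule SA_DA)
  have "L p (pt f x) \<doteq> pt (act_poly \<sigma> f) (rhoc p x)" if "f \<in> polys n" for f x
    using that
  proof (induction f rule: polys_induct)
    case (const c)
    have one: "ymonom n 0 = 1" by (simp add: ymonom_def map_replicate_const)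
    have "L p (J (Poly_Mapping.single 0 (scale c x))) \<doteq> L p (T 1 (scale c x))"
      using J_single[of 0 "scale c x"] pD by (simp add: one L_cong)
    also have "\<dots> = T (1 * p) (scale c x)"
      using pD by (simp add: L_T free_algebra_one)
    also have "\<dots> \<doteq> T 1 (rhoc p (scale c x))"
      by (intro T_rhoc p free_algebra_one)
    also have "\<dots> \<doteq> J (Poly_Mapping.single 0 (scale c (rhoc p x)))"
      using J_single[of 0 "scale c (rhoc p x)"] p by (simp add: one rhoc_scale eqv_sym)
    finally show ?case by (simp add: ptens_simps)
  next
    case (add f g)
    have "L p (pt (f + g) x) \<doteq> L p (pt f x + pt g x)"
      unfolding ptens_simps by (intro L_cong J_add pD)
    also have "\<dots> \<doteq> pt (act_poly \<sigma> f) (rhoc p x) + pt (act_poly \<sigma> g) (rhoc p x)"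
      unfolding L_add by (intro eqv_add add)
    also have "\<dots> \<doteq> pt (act_poly \<sigma> (f + g)) (rhoc p x)"
      unfolding ptens_simps act_poly_add by (intro eqv_sym[OF J_add])
    finally show ?case .
  next
    case (var j f)
    obtain k where k: "k \<in> {1..n}" and kj: "\<sigma> j = yvar k \<and> cl (p * y_gen j) = cl (y_gen k * p)
      \<or> \<sigma> j = - yvar k \<and> cl (p * y_gen j) = cl (- (y_gen k * p))"
      using comm[OF var(1)] by blast
    have D: "y_gen j \<in> DA" "y_gen k \<in> DA" using k var by (auto intro: gens_DA)
    let ?f = "act_poly \<sigma> f" and ?x = "rhoc p x"
    have "L p (pt (yvar j * f) x) \<doteq> L p (L (y_gen j) (pt f x))"
      by (intro L_cong J_yvar_mult var pD)
    also have "\<dots> = L (p * y_gen j) (pt f x)"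
      by (simp add: L_mult P_J pD D)
    finally have 1: "L p (pt (yvar j * f) x) \<doteq> L (p * y_gen j) (pt f x)" .
    have "L (y_gen k * p) (pt f x) = L (y_gen k) (L p (pt f x))"
      by (simp add: L_mult P_J pD D)
    also have "\<dots> \<doteq> L (y_gen k) (pt ?f ?x)"
      by (intro L_cong var D)
    also have "\<dots> \<doteq> pt (yvar k * ?f) ?x"
      by (rule eqv_sym[OF J_yvar_mult[OF k]])
    finally have 2: "L (y_gen k * p) (pt f x) \<doteq> pt (yvar k * ?f) ?x" .
    from kj show ?case
    proof
      assume "\<sigma> j = yvar k \<and> cl (p * y_gen j) = cl (y_gen k * p)"
      then show ?thesis
        using 1 2 L_cl_cong[of "p * y_gen j" "y_gen k * p"] by (auto simp: act_poly_mult intro: eqv_trans)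
    next
      assume neg: "\<sigma> j = - yvar k \<and> cl (p * y_gen j) = cl (- (y_gen k * p))"
      note 1
      also have "L (p * y_gen j) (pt f x) = L (- (y_gen k * p)) (pt f x)"
        using neg L_cl_cong by metis
      also have "\<dots> \<doteq> - L (y_gen k * p) (pt f x)"
        by (intro L_uminus_left P_J free_algebra_mult D pD)
      also have "\<dots> \<doteq> - pt (yvar k * ?f) ?x"
        by (intro eqv_uminus 2)
      also have "\<dots> \<doteq> pt (- (yvar k * ?f)) ?x"
        unfolding ptens_simps by (rule eqv_sym[OF J_uminus])
      finally show ?thesis using neg by (simp add: act_poly_mult)
    qed
  qed
  moreover have "\<sigma> j \<in> polys n" if "j \<in> {1..n}" for j
    using comm[OF that] by (auto intro!: polys_intros)
  ultimately show ?thesis using p by (simp add: intertwines_def)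
qed

lemma intertwines_mult:
  assumes p: "intertwines p \<sigma>" and q: "intertwines q \<tau>"
  shows "intertwines (p * q) (\<lambda>j. act_poly \<sigma> (\<tau> j))"
  unfolding intertwines_def
proof (intro conjI ballI allI)
  note S = intertwinesD(1)[OF p] intertwinesD(1)[OF q]
  show "p * q \<in> SA" using S by (rule free_algebra_mult)
  show "act_poly \<sigma> (\<tau> j) \<in> polys n" if "j \<in> {1..n}" for j
    using that by (intro act_poly_polys intertwinesD(2)[OF p] intertwinesD(2)[OF q])
  fix f x assume f: "f \<in> polys n"
  have "L (p * q) (pt f x) = L p (L q (pt f x))"
    using S by (intro L_mult P_J SA_DA)
  also have "\<dots> \<doteq> L p (pt (act_poly \<tau> f) (rhoc q x))"
    using S f by (intro L_cong intertwinesD(3)[OF q] SA_DA)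
  also have "\<dots> \<doteq> pt (act_poly \<sigma> (act_poly \<tau> f)) (rhoc p (rhoc q x))"
    using f by (intro intertwinesD(3)[OF p] act_poly_polys intertwinesD(2)[OF q])
  finally show "L (p * q) (pt f x) \<doteq> pt (act_poly (\<lambda>j. act_poly \<sigma> (\<tau> j)) f) (rhoc (p * q) x)"
    using S by (simp add: act_poly_act_poly rhoc_mult)
qed

text \<open>The sign is absorbed by the vector factor, so the reflection stays the same.\<close>

lemma intertwines_uminus:
  assumes p: "intertwines p \<sigma>"
  shows "intertwines (- p) \<sigma>"
  unfolding intertwines_def
proof (intro conjI ballI allI)
  note S = intertwinesD(1)[OF p]
  show "- p \<in> SA" using S by (rule free_algebra_uminus)
  fix f x assume f: "f \<in> polys n"
  have "L (- p) (pt f x) \<doteq> - L p (pt f x)"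
    using S by (intro L_uminus_left P_J SA_DA)
  also have "\<dots> \<doteq> - pt (act_poly \<sigma> f) (rhoc p x)"
    using f by (intro eqv_uminus intertwinesD(3)[OF p])
  also have "\<dots> \<doteq> pt (act_poly \<sigma> f) (- rhoc p x)"
    unfolding ptens_simps by (rule eqv_sym[OF J_uminus])
  finally show "L (- p) (pt f x) \<doteq> pt (act_poly \<sigma> f) (rhoc (- p) x)"
    using S by (simp add: rhoc_uminus)
qed (rule intertwinesD(2)[OF p])

lemma intertwines_sign: "intertwines p \<sigma> \<Longrightarrow> intertwines ((- 1) ^ k * p) \<sigma>"
  by (induction k) (simp_all add: mult.assoc intertwines_uminus)

section \<open>Commutation of the generators with the variables\<close>

lemma t_sq: "j \<in> {1..n} \<Longrightarrow> cl (t_gen j * t_gen j) = cl 1"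
  by (rule cl_rel, unfold daha_rels_def spin_rels_def Un_iff mem_Collect_eq) (metis, rule free_algebra_one)

lemma t_y: "i \<in> {1..n-1} \<Longrightarrow> cl (t_gen i * y_gen i) = cl (y_gen (Suc i) * t_gen i)"
  by (rule cl_rel, unfold daha_rels_def Suc_eq_plus1 Un_iff mem_Collect_eq) (metis, auto intro!: DA_intros)

text \<open>Multiplying the relation t_i y_i = y_{i+1} t_i by t_i on both sides and using t_i^2 = 1
  gives the companion relation.\<close>

lemma t_y_Suc:
  assumes i: "i \<in> {1..n-1}"
  shows "cl (t_gen i * y_gen (Suc i)) = cl (y_gen i * t_gen i)"
proof -
  have D: "t_gen i \<in> DA" "y_gen i \<in> DA" "y_gen (Suc i) \<in> DA" and i': "i \<in> {1..n}"
    using i by (auto intro!: gens_DA)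
  have "cl (t_gen i * y_gen (Suc i)) = cl (t_gen i * y_gen (Suc i) * 1)" by simp
  also have "\<dots> = cl (t_gen i * y_gen (Suc i) * (t_gen i * t_gen i))"
    by (rule cl_mult_cong[OF refl t_sq[OF i', symmetric]]) (intro DA_intros D)+
  also have "\<dots> = cl (t_gen i * ((y_gen (Suc i) * t_gen i) * t_gen i))"
    by (simp add: mult.assoc)
  also have "\<dots> = cl (t_gen i * ((t_gen i * y_gen i) * t_gen i))"
    by (rule cl_mult_cong[OF refl cl_mult_cong[OF t_y[OF i, symmetric] refl]]) (intro DA_intros D)+
  also have "\<dots> = cl (t_gen i * t_gen i * (y_gen i * t_gen i))"
    by (simp add: mult.assoc)
  also have "\<dots> = cl (1 * (y_gen i * t_gen i))"
    by (rule cl_mult_cong[OF t_sq[OF i'] refl]) (intro DA_intros D)+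
  finally show ?thesis by simp
qed

lemma t_y_other:
  "i \<in> {1..n-1} \<Longrightarrow> j \<in> {1..n} \<Longrightarrow> j \<noteq> i \<Longrightarrow> j \<noteq> Suc i \<Longrightarrow> cl (t_gen i * y_gen j) = cl (y_gen j * t_gen i)"
  by (rule cl_rel, unfold daha_rels_def Suc_eq_plus1 Un_iff mem_Collect_eq) (metis, auto intro!: DA_intros)

lemma tn_y: "cl (t_gen n * y_gen n) = cl (- (y_gen n * t_gen n))"
  by (rule cl_rel, unfold daha_rels_def diff_minus_eq_add Un_iff mem_Collect_eq)
    (metis insertI1, use n2 in \<open>auto intro!: DA_intros\<close>)

lemma tn_y_other: "j \<in> {1..n} \<Longrightarrow> j \<noteq> n \<Longrightarrow> cl (t_gen n * y_gen j) = cl (y_gen j * t_gen n)"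
  by (rule cl_rel, unfold daha_rels_def Un_iff mem_Collect_eq) (metis, use n2 in \<open>auto intro!: DA_intros\<close>)

lemma intertwines_t_gen:
  assumes i: "i \<in> {1..n-1}"
  shows "intertwines (t_gen i) (swap i (Suc i))"
proof (rule intertwines_of_commutation)
  show "t_gen i \<in> SA" using i by (auto intro!: t_gen_SA)
  fix j assume j: "j \<in> {1..n}"
  let ?k = "if j = i then Suc i else if j = Suc i then i else j"
  have "?k \<in> {1..n}" using i j by auto
  moreover have "swap i (Suc i) j = yvar ?k" by (simp add: swap_def)
  moreover have "cl (t_gen i * y_gen j) = cl (y_gen ?k * t_gen i)"
    using t_y[OF i] t_y_Suc[OF i] t_y_other[OF i j] by simp
  ultimately show "\<exists>k\<in>{1..n}.
      swap i (Suc i) j = yvar k \<and> cl (t_gen i * y_gen j) = cl (y_gen k * t_gen i)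
      \<or> swap i (Suc i) j = - yvar k \<and> cl (t_gen i * y_gen j) = cl (- (y_gen k * t_gen i))"
    by blast
qed

lemma intertwines_t_gen_n: "intertwines (t_gen n) (neg_at n)"
proof (rule intertwines_of_commutation)
  show "t_gen n \<in> SA" using n2 by (auto intro!: t_gen_SA)
  fix j assume "j \<in> {1..n}"
  then show "\<exists>k\<in>{1..n}.
      neg_at n j = yvar k \<and> cl (t_gen n * y_gen j) = cl (y_gen k * t_gen n)
      \<or> neg_at n j = - yvar k \<and> cl (t_gen n * y_gen j) = cl (- (y_gen k * t_gen n))"
    using tn_y tn_y_other[of j] by (intro bexI[of _ j]) (auto simp: neg_at_def)
qed

text \<open>The inductive step for all brackets: one more t_i on each side replaces \<sigma> by its
  conjugate under s_i, which each use identifies by evaluating on variables.\<close>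

lemma intertwines_conj:
  assumes "intertwines p \<sigma>" "i \<in> {1..n-1}"
    and "(\<lambda>j. act_poly (swap i (Suc i)) (act_poly \<sigma> (swap i (Suc i) j))) = \<tau>"
  shows "intertwines (t_gen i * p * t_gen i) \<tau>"
  using intertwines_mult[OF intertwines_t_gen[OF assms(2)] intertwines_mult[OF assms(1) intertwines_t_gen[OF assms(2)]]]
    assms(3) by (simp add: mult.assoc)

text \<open>Conjugating s_{ij} by s_j gives s_{i,j+1}, so the upper index climbs from i + 1, where
  the product is t_i alone.\<close>

lemma intertwines_bracket_lt:
  assumes "1 \<le> i" "i < j" "j \<le> n"
  shows "intertwines (bracket_lt i j) (swap i j)"
proof -
  have "intertwines (t_down (j - 1) (i + 1) * t_gen i * t_up (i + 1) (j - 1)) (swap i j)"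
    using Suc_leI[OF assms(2)] assms(3)
  proof (induction j rule: dec_induct)
    case base
    then show ?case
      using intertwines_t_gen[of i] assms(1) by (simp add: t_up_empty t_down_empty)
  next
    case (step j)
    \<comment> \<open>The new upper end \<open>Suc j - 1\<close> simplifies to j, and the recursions
      for \<open>t_up\<close> and \<open>t_down\<close> rewrite only at a successor.\<close>
    then obtain k where k: "j = Suc k" using assms(1) by (cases j) auto
    have "intertwines (t_gen j * (t_down (j - 1) (i + 1) * t_gen i * t_up (i + 1) (j - 1)) * t_gen j) (swap i (Suc j))"
    proof (rule intertwines_conj)
      show "(\<lambda>m. act_poly (swap j (Suc j)) (act_poly (swap i j) (swap j (Suc j) m))) = swap i (Suc j)"
        using step.hyps by (intro ext) (auto simp: swap_def)
    qed (use step assms(1) in auto)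
    then show ?case
      using step.hyps by (simp add: k t_up_Suc t_down_Suc mult.assoc)
  qed
  then show ?thesis
    unfolding bracket_lt_def mult.assoc by (rule intertwines_sign)
qed

lemma intertwines_bracket:
  assumes "i \<in> {1..n}" "k \<in> {1..n}" "k \<noteq> i"
  shows "intertwines (bracket k i) (swap k i)"
proof -
  have "swap k i = swap i k" by (auto simp: swap_def)
  then show ?thesis
    using assms intertwines_bracket_lt[of k i] intertwines_uminus[OF intertwines_bracket_lt[of i k]]
    by (auto simp: bracket_def)
qed

text \<open>The core t_n t_{n-1} t_n gives the signed swap of y_{n-1} and y_n. Two downward
  inductions then conjugate it, lowering n - 1 to i and afterwards n to j; in the second, i < j
  guarantees that the conjugating transposition fixes y_i.\<close>

lemma intertwines_bar_bracket_lt: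
  assumes "1 \<le> i" "i < j" "j \<le> n"
  shows "intertwines (bar_bracket_lt n i j) (neg_swap i j)"
proof -
  have i: "i \<le> n - 1" using assms by simp
  have inner: "intertwines (t_up i (n - 2) * (t_gen n * t_gen (n - 1) * t_gen n) * t_down (n - 2) i) (neg_swap i n)"
    using i assms(1)
  proof (induction i rule: inc_induct)
    case base
    have "(\<lambda>m. act_poly (neg_at n) (act_poly (swap (n - 1) n) (neg_at n m))) = neg_swap (n - 1) n"
      using n2 by (intro ext) (auto simp: neg_at_def swap_def neg_swap_def act_poly_uminus)
    moreover have t: "intertwines (t_gen (n - 1)) (swap (n - 1) n)"
      using intertwines_t_gen[of "n - 1"] n2 by simp
    ultimately show ?case
      using intertwines_mult[OF intertwines_t_gen_n intertwines_mult[OF t intertwines_t_gen_n]] n2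
      by (simp add: t_up_empty t_down_empty mult.assoc)
  next
    case (step i)
    have "intertwines (t_gen i * (t_up (Suc i) (n - 2) * (t_gen n * t_gen (n - 1) * t_gen n) * t_down (n - 2) (Suc i)) * t_gen i)
      (neg_swap i n)"
    proof (rule intertwines_conj)
      show "(\<lambda>m. act_poly (swap i (Suc i)) (act_poly (neg_swap (Suc i) n) (swap i (Suc i) m))) = neg_swap i n"
        using step.hyps by (intro ext) (auto simp: swap_def neg_swap_def act_poly_uminus)
    qed (use step in auto)
    then show ?case
      using step.hyps by (simp add: t_up_rec t_down_rec mult.assoc)
  qed
  have "intertwines (t_up j (n - 1) * (t_up i (n - 2) * (t_gen n * t_gen (n - 1) * t_gen n) * t_down (n - 2) i)
      * t_down (n - 1) j) (neg_swap i j)"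
    using assms(3,2)
  proof (induction j rule: inc_induct)
    case base
    then show ?case using inner n2 by (simp add: t_up_empty t_down_empty)
  next
    case (step j)
    have "intertwines (t_gen j * (t_up (Suc j) (n - 1) * (t_up i (n - 2) * (t_gen n * t_gen (n - 1) * t_gen n) * t_down (n - 2) i)
        * t_down (n - 1) (Suc j)) * t_gen j) (neg_swap i j)"
    proof (rule intertwines_conj)
      show "(\<lambda>m. act_poly (swap j (Suc j)) (act_poly (neg_swap i (Suc j)) (swap j (Suc j) m))) = neg_swap i j"
        using step by (intro ext) (auto simp: swap_def neg_swap_def act_poly_uminus)
    qed (use step in auto)
    then show ?case
      using step.hyps by (simp add: t_up_rec t_down_rec mult.assoc)
  qed
  then show ?thesis
    unfolding bar_bracket_lt_def mult.assoc by (rule intertwines_sign)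
qed

lemma intertwines_bar_bracket:
  assumes "i \<in> {1..n}" "k \<in> {1..n}" "k \<noteq> i"
  shows "intertwines (bar_bracket n k i) (neg_swap k i)"
proof -
  have "neg_swap k i = neg_swap i k" by (auto simp: neg_swap_def)
  then show ?thesis
    using assms intertwines_bar_bracket_lt[of k i] intertwines_bar_bracket_lt[of i k]
    by (auto simp: bar_bracket_def)
qed

text \<open>Conjugation by s_i turns the sign change at i + 1 into the one at i, starting from
  t_n.\<close>

lemma intertwines_bar_single:
  assumes "i \<in> {1..n}"
  shows "intertwines (bar_single n i) (neg_at i)"
proof -
  have i: "i \<le> n" "1 \<le> i" using assms by auto
  then have "intertwines (t_up i (n - 1) * t_gen n * t_down (n - 1) i) (neg_at i)"
  proof (induction i rule: inc_induct)
    case base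
    then show ?case using intertwines_t_gen_n n2 by (simp add: t_up_empty t_down_empty)
  next
    case (step i)
    have "intertwines (t_gen i * (t_up (Suc i) (n - 1) * t_gen n * t_down (n - 1) (Suc i)) * t_gen i) (neg_at i)"
    proof (rule intertwines_conj)
      show "(\<lambda>m. act_poly (swap i (Suc i)) (act_poly (neg_at (Suc i)) (swap i (Suc i) m))) = neg_at i"
        by (intro ext) (auto simp: swap_def neg_at_def act_poly_uminus)
    qed (use step in auto)
    then show ?case
      using step.hyps by (simp add: t_up_rec t_down_rec mult.assoc)
  qed
  then show ?thesis
    unfolding bar_single_def mult.assoc by (rule intertwines_sign)
qed

section \<open>Dunkl operators\<close>

lemma ptens_const_mult: "ptens scale (Poly_Mapping.single 0 c * g) x = tscale scale c (ptens scale g x)"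
  by (rule poly_mapping_eqI)
    (auto simp: lookup_ptens lookup_tscale
      Poly_Mapping.map.rep_eq when_def simp flip: mult_map_scale_conv_mult)

text \<open>Here the Leibniz rule meets the bracket: its twisted term, f^\<sigma> tensored with b x,
  is b applied to f tensored with x.\<close>

lemma pt_divdiff_yvar_mult:
  assumes b: "intertwines b \<sigma>" and d: "divides_moves n \<sigma> q \<delta>" and f: "f \<in> polys n" and j: "j \<in> {1..n}"
  shows "pt (divdiff \<sigma> q (yvar j * f)) (rhoc b x)
    \<doteq> L (y_gen j) (pt (divdiff \<sigma> q f) (rhoc b x)) + L (scal (\<delta> j) * b) (pt f x)"
proof -
  let ?x = "rhoc b x" and ?g = "divdiff \<sigma> q f" and ?c = "Poly_Mapping.single 0 (\<delta> j)"
  have "pt (divdiff \<sigma> q (yvar j * f)) ?x \<doteq> pt (yvar j * ?g) ?x + pt (?c * act_poly \<sigma> f) ?x"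
    unfolding divdiff_yvar_mult[OF d f j] ptens_simps by (rule J_add)
  also have "\<dots> \<doteq> L (y_gen j) (pt ?g ?x) + L (scal (\<delta> j)) (pt (act_poly \<sigma> f) ?x)"
    unfolding ptens_const_mult by (intro eqv_add J_yvar_mult J_tscale j)
  also have "\<dots> \<doteq> L (y_gen j) (pt ?g ?x) + L (scal (\<delta> j)) (L b (pt f x))"
    by (intro eqv_add eqv_refl L_cong eqv_sym[OF intertwinesD(3)[OF b f]] free_algebra_scal)
  also have "L (scal (\<delta> j)) (L b (pt f x)) = L (scal (\<delta> j) * b) (pt f x)"
    using intertwinesD(1)[OF b] by (simp add: L_mult P_J SA_DA free_algebra_scal)
  finally show ?thesis .
qed

lemma L_scal_commute:
  "c \<in> carrier P \<Longrightarrow> p \<in> DA \<Longrightarrow> L p (L (scal a) c) = L (scal a) (L p c)"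
  by (simp add: free_algebra_scal scal_mult_commute flip: L_mult)

section \<open>The commutator of \<open>\<xi>\<^sub>i\<close> and \<open>y\<^sub>j\<close>\<close>

definition swap_coeff :: "nat \<Rightarrow> nat \<Rightarrow> nat \<Rightarrow> complex" where
  "swap_coeff i k j = (if j = i then 1 else if j = k then - 1 else 0)"
definition neg_swap_coeff :: "nat \<Rightarrow> nat \<Rightarrow> nat \<Rightarrow> complex" where
  "neg_swap_coeff i k j = (if j = i \<or> j = k then 1 else 0)"
definition neg_at_coeff :: "nat \<Rightarrow> nat \<Rightarrow> complex" where
  "neg_at_coeff i j = (if j = i then 1 else 0)"

text \<open>The commutator of \<open>\<xi>\<^sub>i\<close> and \<open>y\<^sub>j\<close>, for \<open>j = i\<close> and \<open>j \<noteq> i\<close> alike, with the constants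
  \<open>\<Delta>(y\<^sub>j)\<close> as coefficients.\<close>

definition xi_comm :: "nat \<Rightarrow> nat \<Rightarrow> falg" where
  "xi_comm i j = scal u * (\<Sum>k\<in>{1..n}-{i}. scal (swap_coeff i k j) * bracket k i)
     - scal u * (\<Sum>k\<in>{1..n}-{i}. scal (neg_swap_coeff i k j) * bar_bracket n k i)
     - scal v * (scal (neg_at_coeff i j) * bar_single n i)"

lemma scal_zero: "scal 0 = 0"
  by (simp add: scal_def)

text \<open>All coefficients are 1. Antisymmetry of the bracket and symmetry of the barred bracket
  turn the difference of the two sums into minus the sum in the relation.\<close>

lemma xi_comm_same: "xi_comm i i =
    - (scal u * (\<Sum>k\<in>{1..n}-{i}. bracket i k + bar_bracket n i k) + scal v * bar_single n i)"
proof -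
  have "(\<Sum>k\<in>{1..n}-{i}. bracket k i) = (\<Sum>k\<in>{1..n}-{i}. - bracket i k)"
    by (rule sum.cong) (auto simp: bracket_def)
  moreover have "(\<Sum>k\<in>{1..n}-{i}. bar_bracket n k i) = (\<Sum>k\<in>{1..n}-{i}. bar_bracket n i k)"
    by (rule sum.cong) (auto simp: bar_bracket_def)
  ultimately show ?thesis
    by (simp add: xi_comm_def swap_coeff_def neg_swap_coeff_def neg_at_coeff_def scal_one
        sum_negf sum.distrib distrib_left)
qed

text \<open>Only k = j survives; there the coefficient -1 turns [j,i] into [i,j].\<close>

lemma xi_comm_distinct:
  assumes "j \<in> {1..n}" "i \<noteq> j"
  shows "xi_comm i j = - (- scal u * bracket i j + scal u * bar_bracket n i j)"
proof -
  have "(\<Sum>k\<in>{1..n}-{i}. scal (swap_coeff i k j) * bracket k i)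
      = (\<Sum>k\<in>{1..n}-{i}. if k = j then bracket i j else 0)"
    using assms(2) by (intro sum.cong) (auto simp: swap_coeff_def scal_zero scal_minus_one bracket_def)
  also have "\<dots> = bracket i j" using assms by (simp add: sum.delta)
  finally have 1: "(\<Sum>k\<in>{1..n}-{i}. scal (swap_coeff i k j) * bracket k i) = bracket i j" .
  have "(\<Sum>k\<in>{1..n}-{i}. scal (neg_swap_coeff i k j) * bar_bracket n k i)
      = (\<Sum>k\<in>{1..n}-{i}. if k = j then bar_bracket n i j else 0)"
    using assms(2) by (intro sum.cong) (auto simp: neg_swap_coeff_def scal_zero scal_one bar_bracket_def)
  also have "\<dots> = bar_bracket n i j" using assms by (simp add: sum.delta)
  finally show ?thesis
    using 1 assms by (simp add: xi_comm_def neg_at_coeff_def scal_zero)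
qed

lemma brackets_DA:
  assumes "i \<in> {1..n}"
  shows "k \<in> {1..n} - {i} \<Longrightarrow> bracket k i \<in> DA" "k \<in> {1..n} - {i} \<Longrightarrow> bar_bracket n k i \<in> DA"
    "bar_single n i \<in> DA"
  using intertwines_bracket[of i k] intertwines_bar_bracket[of i k] intertwines_bar_single[of i] assms
  by (auto dest: intertwinesD(1) SA_DA)

lemma xi_comm_DA: "i \<in> {1..n} \<Longrightarrow> xi_comm i j \<in> DA"
  unfolding xi_comm_def
  by (intro free_algebra_diff free_algebra_mult free_algebra_scal free_algebra_sum brackets_DA)

lemma xi_y:
  assumes i: "i \<in> {1..n}" and j: "j \<in> {1..n}"
  shows "cl (xi_gen i * y_gen j) = cl (y_gen j * xi_gen i + xi_comm i j)"
proof (rule cl_rel[symmetric])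
  show "xi_gen i * y_gen j \<in> DA" using assms by (intro DA_intros)
  \<comment> \<open>The defining relations list the opposite commutator, which is why the negative
    of \<open>xi_comm\<close> appears.\<close>
  have "y_gen j * xi_gen i - xi_gen i * y_gen j - (- xi_comm i j) \<in> daha_rels n u v"
  proof (cases "i = j")
    case True
    show ?thesis
      unfolding True xi_comm_same minus_minus daha_rels_def Un_iff mem_Collect_eq using j by metis
  next
    case False
    show ?thesis
      unfolding xi_comm_distinct[OF j False] minus_minus daha_rels_def Un_iff mem_Collect_eq
      using i j False by metis
  qed
  then show "y_gen j * xi_gen i + xi_comm i j - xi_gen i * y_gen j \<in> daha_rels n u v"
    by (simp add: algebra_simps)
qed

section \<open>The Dunkl operator and its representatives\<close>

definition dunkl :: "nat \<Rightarrow> cpoly \<Rightarrow> 'v \<Rightarrow> (nat \<Rightarrow>\<^sub>0 nat) \<Rightarrow>\<^sub>0 'v" where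
  "dunkl i f x =
     tscale scale u (\<Sum>k\<in>{1..n}-{i}. ptens scale (divdiff (swap k i) (yvar i - yvar k) f) (rhoc (bracket k i) x))
   - tscale scale u (\<Sum>k\<in>{1..n}-{i}. ptens scale (divdiff (neg_swap k i) (yvar i + yvar k) f) (rhoc (bar_bracket n k i) x))
   - tscale scale v (ptens scale (divdiff (neg_at i) (2 * yvar i) f) (rhoc (bar_single n i) x))"

text \<open>The representative of \<open>dunkl\<close> with \<open>J\<close> pushed inside sums and
  scalars: \<open>L\<close> is additive on representatives exactly, \<open>J\<close> only up to
  \<doteq>, so rearrangements become plain algebra.\<close>

definition dunkl_frag :: "nat \<Rightarrow> cpoly \<Rightarrow> 'v \<Rightarrow> (falg set \<times> 'v) \<Rightarrow>\<^sub>0 int" where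
  "dunkl_frag i f x =
     L (scal u) (\<Sum>k\<in>{1..n}-{i}. pt (divdiff (swap k i) (yvar i - yvar k) f) (rhoc (bracket k i) x))
   - L (scal u) (\<Sum>k\<in>{1..n}-{i}. pt (divdiff (neg_swap k i) (yvar i + yvar k) f) (rhoc (bar_bracket n k i) x))
   - L (scal v) (pt (divdiff (neg_at i) (2 * yvar i) f) (rhoc (bar_single n i) x))"

lemma J_tscale_sum: "J (tscale scale c (\<Sum>k\<in>K. z k)) \<doteq> L (scal c) (\<Sum>k\<in>K. J (z k))"
  by (rule eqv_trans[OF J_tscale]) (intro L_cong J_sum free_algebra_scal)

lemma J_dunkl: "J (dunkl i f x) \<doteq> dunkl_frag i f x"
  unfolding dunkl_def dunkl_frag_def
  by (rule eqv_trans[OF J_diff] eqv_diff J_tscale_sum J_tscale)+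

lemma moves:
  assumes "i \<in> {1..n}"
  shows "k \<in> {1..n} - {i} \<Longrightarrow> divides_moves n (swap k i) (yvar i - yvar k) (swap_coeff i k)"
    "k \<in> {1..n} - {i} \<Longrightarrow> divides_moves n (neg_swap k i) (yvar i + yvar k) (neg_swap_coeff i k)"
    "divides_moves n (neg_at i) (2 * yvar i) (neg_at_coeff i)"
  using divides_moves_swap[of i n k] divides_moves_neg_swap[of i n k] divides_moves_neg_at[of i n] assms
  by (auto simp: swap_coeff_def[abs_def] neg_swap_coeff_def[abs_def] neg_at_coeff_def[abs_def])

lemma brackets_intertwine:
  assumes "i \<in> {1..n}"
  shows "k \<in> {1..n} - {i} \<Longrightarrow> intertwines (bracket k i) (swap k i)"
    "k \<in> {1..n} - {i} \<Longrightarrow> intertwines (bar_bracket n k i) (neg_swap k i)"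
    "intertwines (bar_single n i) (neg_at i)"
  using intertwines_bracket[of i k] intertwines_bar_bracket[of i k] intertwines_bar_single[of i] assms by auto

lemma L_xi_comm:
  assumes i: "i \<in> {1..n}" and c: "c \<in> carrier P"
  shows "L (xi_comm i j) c
    \<doteq> L (scal u) (\<Sum>k\<in>{1..n}-{i}. L (scal (swap_coeff i k j) * bracket k i) c)
      - L (scal u) (\<Sum>k\<in>{1..n}-{i}. L (scal (neg_swap_coeff i k j) * bar_bracket n k i) c)
      - L (scal v) (L (scal (neg_at_coeff i j) * bar_single n i) c)"
proof -
  let ?K = "{1..n}-{i}"
  have split: "L (scal a * sum p ?K) c \<doteq> L (scal a) (\<Sum>k\<in>?K. L (p k) c)" if "\<And>k. k \<in> ?K \<Longrightarrow> p k \<in> DA" for a p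
  proof -
    have "L (scal a * sum p ?K) c = L (scal a) (L (sum p ?K) c)"
      by (intro L_mult c free_algebra_scal free_algebra_sum that)
    also have "\<dots> \<doteq> L (scal a) (\<Sum>k\<in>?K. L (p k) c)"
      by (intro L_cong L_sum_left c free_algebra_scal that)
    finally show ?thesis .
  qed
  note D = free_algebra_diff free_algebra_mult free_algebra_scal free_algebra_sum brackets_DA[OF i]
  have "L (xi_comm i j) c
    \<doteq> L (scal u * (\<Sum>k\<in>?K. scal (swap_coeff i k j) * bracket k i)) c
      - L (scal u * (\<Sum>k\<in>?K. scal (neg_swap_coeff i k j) * bar_bracket n k i)) c
      - L (scal v * (scal (neg_at_coeff i j) * bar_single n i)) c"
  proof -
    let ?p = "scal u * (\<Sum>k\<in>?K. scal (swap_coeff i k j) * bracket k i)"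
    let ?q = "scal u * (\<Sum>k\<in>?K. scal (neg_swap_coeff i k j) * bar_bracket n k i)"
    let ?r = "scal v * (scal (neg_at_coeff i j) * bar_single n i)"
    have p: "?p \<in> DA" and q: "?q \<in> DA" and r: "?r \<in> DA" by (intro D; assumption)+
    have "L (?p - ?q - ?r) c \<doteq> L (?p - ?q) c - L ?r c"
      by (intro L_minus_left free_algebra_diff c p q r)
    also have "\<dots> \<doteq> L ?p c - L ?q c - L ?r c"
      by (intro eqv_diff L_minus_left eqv_refl c p q)
    finally show ?thesis unfolding xi_comm_def .
  qed
  also have "\<dots> \<doteq> L (scal u) (\<Sum>k\<in>?K. L (scal (swap_coeff i k j) * bracket k i) c)
      - L (scal u) (\<Sum>k\<in>?K. L (scal (neg_swap_coeff i k j) * bar_bracket n k i) c)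
      - L (scal v * (scal (neg_at_coeff i j) * bar_single n i)) c"
    by (intro eqv_diff split eqv_refl D)
  also have "L (scal v * (scal (neg_at_coeff i j) * bar_single n i)) c
      = L (scal v) (L (scal (neg_at_coeff i j) * bar_single n i) c)"
    by (intro L_mult c D)
  finally show ?thesis .
qed

lemma dunkl_frag_yvar_mult:
  assumes i: "i \<in> {1..n}" and j: "j \<in> {1..n}" and f: "f \<in> polys n"
  shows "dunkl_frag i (yvar j * f) x \<doteq> L (y_gen j) (dunkl_frag i f x) + L (xi_comm i j) (pt f x)"
proof -
  let ?K = "{1..n}-{i}" and ?Y = "L (y_gen j)" and ?F = "pt f x"
  let ?A = "\<lambda>f k. pt (divdiff (swap k i) (yvar i - yvar k) f) (rhoc (bracket k i) x)"
  let ?B = "\<lambda>f k. pt (divdiff (neg_swap k i) (yvar i + yvar k) f) (rhoc (bar_bracket n k i) x)"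
  let ?C = "\<lambda>f. pt (divdiff (neg_at i) (2 * yvar i) f) (rhoc (bar_single n i) x)"
  let ?a = "\<lambda>k. L (scal (swap_coeff i k j) * bracket k i) ?F"
  let ?b = "\<lambda>k. L (scal (neg_swap_coeff i k j) * bar_bracket n k i) ?F"
  let ?c = "L (scal (neg_at_coeff i j) * bar_single n i) ?F"
  note step = pt_divdiff_yvar_mult[OF brackets_intertwine(1)[OF i] moves(1)[OF i] f j]
    pt_divdiff_yvar_mult[OF brackets_intertwine(2)[OF i] moves(2)[OF i] f j]
    pt_divdiff_yvar_mult[OF brackets_intertwine(3)[OF i] moves(3)[OF i] f j]
  have "dunkl_frag i (yvar j * f) x \<doteq> L (scal u) (\<Sum>k\<in>?K. ?Y (?A f k) + ?a k)
      - L (scal u) (\<Sum>k\<in>?K. ?Y (?B f k) + ?b k) - L (scal v) (?Y (?C f) + ?c)"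
    unfolding dunkl_frag_def by (intro eqv_diff L_cong eqv_sum step free_algebra_scal; assumption)
  \<comment> \<open>Since scalars are central, y_j comes out of the Leibniz terms; what is left over
    is the expansion of the commutator.\<close>
  also have "\<dots> = ?Y (dunkl_frag i f x)
      + (L (scal u) (\<Sum>k\<in>?K. ?a k) - L (scal u) (\<Sum>k\<in>?K. ?b k) - L (scal v) ?c)"
    unfolding dunkl_frag_def
    using j by (simp add: L_scal_commute P_sum P_J gens_DA L_diff L_add sum.distrib flip: L_sum)
  also have "\<dots> \<doteq> ?Y (dunkl_frag i f x) + L (xi_comm i j) ?F"
    by (intro eqv_add eqv_refl eqv_sym[OF L_xi_comm] i P_J)
  finally show ?thesis .
qed

lemma dunkl_frag_const:
  assumes "i \<in> {1..n}"
  shows "dunkl_frag i (Poly_Mapping.single 0 c) x = 0"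
  unfolding dunkl_frag_def
  by (simp add: divdiff_const[OF moves(1)[OF assms]] divdiff_const[OF moves(2)[OF assms]]
      divdiff_const[OF moves(3)[OF assms]] ptens_simps J_zero)

lemma dunkl_frag_add:
  assumes i: "i \<in> {1..n}" and f: "f \<in> polys n" and g: "g \<in> polys n"
  shows "dunkl_frag i (f + g) x \<doteq> dunkl_frag i f x + dunkl_frag i g x"
proof -
  let ?K = "{1..n}-{i}"
  let ?A = "\<lambda>f k. pt (divdiff (swap k i) (yvar i - yvar k) f) (rhoc (bracket k i) x)"
  let ?B = "\<lambda>f k. pt (divdiff (neg_swap k i) (yvar i + yvar k) f) (rhoc (bar_bracket n k i) x)"
  let ?C = "\<lambda>f. pt (divdiff (neg_at i) (2 * yvar i) f) (rhoc (bar_single n i) x)"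
  have step: "pt (divdiff \<sigma> q (f + g)) y \<doteq> pt (divdiff \<sigma> q f) y + pt (divdiff \<sigma> q g) y"
    if "divides_moves n \<sigma> q \<delta>" for \<sigma> q \<delta> y
    unfolding divdiff_add[OF that f g] ptens_simps by (rule J_add)
  have "dunkl_frag i (f + g) x \<doteq> L (scal u) (\<Sum>k\<in>?K. ?A f k + ?A g k)
      - L (scal u) (\<Sum>k\<in>?K. ?B f k + ?B g k) - L (scal v) (?C f + ?C g)"
    unfolding dunkl_frag_def
    by (intro eqv_diff L_cong eqv_sum free_algebra_scal) (rule step, erule moves[OF i] | rule step, rule moves[OF i])+
  then show ?thesis by (simp add: dunkl_frag_def L_add sum.distrib algebra_simps)
qed

lemma xi_pt:
  assumes i: "i \<in> {1..n}" and "f \<in> polys n"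
  shows "L (xi_gen i) (pt f x) \<doteq> dunkl_frag i f x"
  using assms(2)
proof (induction f rule: polys_induct)
  case (const c)
  have one: "ymonom n 0 = 1" by (simp add: ymonom_def map_replicate_const)
  have "L (xi_gen i) (J (Poly_Mapping.single 0 (scale c x))) \<doteq> L (xi_gen i) (T 1 (scale c x))"
    using J_single[of 0 "scale c x"] i by (simp add: one L_cong gens_DA)
  also have "\<dots> = T (1 * xi_gen i) (scale c x)"
    using i by (simp add: L_T free_algebra_one gens_DA)
  also have "\<dots> \<doteq> 0"
    by (intro T_xi i free_algebra_one)
  finally show ?case by (simp add: ptens_simps dunkl_frag_const[OF i])
next
  case (add f g)
  have "L (xi_gen i) (pt (f + g) x) \<doteq> L (xi_gen i) (pt f x + pt g x)"
    unfolding ptens_simps by (intro L_cong J_add gens_DA i)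
  also have "\<dots> \<doteq> dunkl_frag i f x + dunkl_frag i g x"
    unfolding L_add by (intro eqv_add add)
  also have "\<dots> \<doteq> dunkl_frag i (f + g) x"
    by (intro eqv_sym[OF dunkl_frag_add] i add)
  finally show ?case .
next
  case (var j f)
  have D: "xi_gen i \<in> DA" "y_gen j \<in> DA" using i var by (auto intro: gens_DA)
  have "L (xi_gen i) (pt (yvar j * f) x) \<doteq> L (xi_gen i) (L (y_gen j) (pt f x))"
    by (intro L_cong J_yvar_mult var D)
  also have "\<dots> = L (xi_gen i * y_gen j) (pt f x)"
    by (simp add: L_mult P_J D)
  also have "\<dots> = L (y_gen j * xi_gen i + xi_comm i j) (pt f x)"
    using xi_y[OF i var(1)] L_cl_cong by metis
  also have "\<dots> \<doteq> L (y_gen j * xi_gen i) (pt f x) + L (xi_comm i j) (pt f x)"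
    by (intro L_plus P_J free_algebra_mult D xi_comm_DA i)
  also have "L (y_gen j * xi_gen i) (pt f x) = L (y_gen j) (L (xi_gen i) (pt f x))"
    by (simp add: L_mult P_J D)
  also have "L (y_gen j) (L (xi_gen i) (pt f x)) + L (xi_comm i j) (pt f x)
      \<doteq> L (y_gen j) (dunkl_frag i f x) + L (xi_comm i j) (pt f x)"
    by (intro eqv_add L_cong var D eqv_refl)
  also have "\<dots> \<doteq> dunkl_frag i (yvar j * f) x"
    by (intro eqv_sym[OF dunkl_frag_yvar_mult] i var)
  finally show ?case .
qed

lemma ind_act_xi:
  assumes "i \<in> {1..n}" "f \<in> polys n"
  shows "ind_act n u v rho (cl (xi_gen i)) (ident n u v rho (ptens scale f x)) = ident n u v rho (dunkl i f x)"
  unfolding ident_J ind_act_ind_cls[OF gens_DA(3)[OF assms(1)]]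
  by (rule ind_cls_cong) (rule eqv_trans[OF xi_pt[OF assms] eqv_sym[OF J_dunkl]])

lemma ptens_poly_tensor: "f \<in> polys n \<Longrightarrow> ptens scale f x \<in> poly_tensor n"
  by (auto simp: polys_def poly_tensor_def in_keys_iff lookup_ptens)

lemma tscale_poly_tensor: "z \<in> poly_tensor n \<Longrightarrow> tscale scale c z \<in> poly_tensor n"
  by (auto simp: poly_tensor_def in_keys_iff lookup_tscale)

text \<open>\<open>the_inv_into\<close> recovers an element from its image only inside
  \<open>poly_tensor n\<close>, so the divided differences must stay polynomials in the n
  variables.\<close>

lemma dunkl_poly_tensor:
  assumes "i \<in> {1..n}" "f \<in> polys n"
  shows "dunkl i f x \<in> poly_tensor n"
  unfolding dunkl_def
  by (intro poly_tensor_diff tscale_poly_tensor poly_tensor_sum ptens_poly_tensor)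
    (rule divdiff_polys[OF moves(1)[OF assms(1)] assms(2)] divdiff_polys[OF moves(2)[OF assms(1)] assms(2)]
      divdiff_polys[OF moves(3)[OF assms(1)] assms(2)]; assumption)+

end

theorem proposition6p5:
  fixes n i :: nat and u v :: complex
    and scale :: "complex \<Rightarrow> 'v::ab_group_add \<Rightarrow> 'v"
    and rho :: "falg set \<Rightarrow> 'v \<Rightarrow> 'v"
    and f :: cpoly and x :: 'v
  assumes "n \<ge> 2" and "spin_module scale n rho"
    and "i \<in> {1..n}" and "f \<in> polys n"
  shows "let D =
       tscale scale u (\<Sum>k\<in>{1..n}-{i}.
         ptens scale (pquot (f - act_poly (swap k i) f) (yvar i - yvar k))
           (rho (spin_cls n (bracket k i)) x))
     - tscale scale u (\<Sum>k\<in>{1..n}-{i}.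
         ptens scale (pquot (f - act_poly (neg_swap k i) f) (yvar i + yvar k))
           (rho (spin_cls n (bar_bracket n k i)) x))
     - tscale scale v
         (ptens scale (pquot (f - act_poly (neg_at i) f) (2 * yvar i))
           (rho (spin_cls n (bar_single n i)) x))
   in ind_act n u v rho (daha_cls n u v (xi_gen i)) (ident n u v rho (ptens scale f x))
        = ident n u v rho D
    \<and> (bij_betw (ident n u v rho) (poly_tensor n) (carrier (V_xi n u v rho))
        \<longrightarrow> poly_act n u v rho (daha_cls n u v (xi_gen i)) (ptens scale f x) = D)"
proof -
  interpret spin_induction scale n rho u v
    using assms(1,2) by (simp add: spin_induction_def spin_induction_axioms_def)
  note xi = ind_act_xi[OF assms(3,4), of x]
  \<comment> \<open>Injectivity of \<open>ident\<close> on \<open>poly_tensor n\<close> cancels it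
    from the equation \<open>xi\<close>.\<close>
  have "poly_act n u v rho (daha_cls n u v (xi_gen i)) (ptens scale f x) = dunkl i f x"
    if "bij_betw (ident n u v rho) (poly_tensor n) (carrier (V_xi n u v rho))"
    using that dunkl_poly_tensor[OF assms(3,4)]
    by (simp add: poly_act_def xi bij_betw_def the_inv_into_f_f)
  with xi show ?thesis
    by (simp only: Let_def dunkl_def divdiff_def rhoc_def) simp
qed

end
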